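(* Let $(\mathcal{T},d,r,p)$ be an IP tree. Then $p$ can be decomposed uniquely as $p=p^a+p^s+p^l$, where $p^a$ is a purely atomic measure, $p^s$ is the restriction of length measure to a subset of the skeleton of $\mathcal{T}$, and $p^l$ is a diffuse (non-atomic) measure on the set of leaves of $\mathcal{T}$.
   Context: A real tree ($\mathbb{R}$-tree) is a complete, separable, bounded metric space $(\mathcal{T},d)$ such that (i) for all $x,y\in\mathcal{T}$ there is a unique non-self-intersecting path from $x$ to $y$, called the segment $[[x,y]]_{\mathcal{T}}$, and (ii) each segment is isometric to a closed real interval. Compactness is not required. A rooted, weighted $\mathbb{R}$-tree is a quadruple $(\mathcal{T},d,r,p)$ with $(\mathcal{T},d)$ an $\mathbb{R}$-tree, $r\in\mathcal{T}$ (the root), and $p$ a Borel probability measure on $\mathcal{T}$. The fringe subtree at $x$ is $F_x(\mathcal{T}):=\{y\in\mathcal{T}: x\in[[r,y]]_{\mathcal{T}}\}$. A branch point is a point $x$ for which there exist three non-trivial segments with endpoint $x$ whose pairwise intersections all equal $\{x\}$. A leaf is a point that is an endpoint of every segment to which it belongs. The skeleton of $\mathcal{T}$ is the complement of the set of leaves. Length measure is the measure on the skeleton that assigns to each segment its length. An interval partition tree (IP tree) is a rooted, weighted $\mathbb{R}$-tree $(\mathcal{T},d,r,p)$ such that: (Spanning) $\mathcal{T}=\bigcup_{x\in\mathrm{support}(p)}[[r,x]]_{\mathcal{T}}$ (closed support), i.e. every leaf is in the closed support of $p$; (Spacing) for every $x\in\mathcal{T}$ that is a branch point or lies in the closed support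 of $p$, $d(r,x)+p(F_x(\mathcal{T}))=1$. *)

theory Defs
  imports "HOL-Analysis.Analysis" "HOL-Probability.Probability_Measure"
begin

text \<open>
  The underlying space of a tree is a whole type of class \<open>polish_space\<close>; this class provides
  the metric together with completeness and separability.
\<close>

(* Non-self-intersecting paths are identified with their images.  The library's arcs are injective
   on {0..1}, so the trivial path from x to x has to be added by hand; when x = y it is the only
   possibility. *)
definition arc_image :: "'a::topological_space \<Rightarrow> 'a \<Rightarrow> 'a set \<Rightarrow> bool" where
  "arc_image x y S \<longleftrightarrow>
     (x = y \<and> S = {x}) \<or>
     (\<exists>g. arc g \<and> pathstart g = x \<and> pathfinish g = y \<and> S = path_image g)"

definition segment :: "'a::topological_space \<Rightarrow> 'a \<Rightarrow> 'a set" where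
  "segment x y = (THE S. arc_image x y S)"

definition real_tree :: "'a::polish_space itself \<Rightarrow> bool" where
  "real_tree _ \<longleftrightarrow>
     bounded (UNIV :: 'a set) \<and>
     (\<forall>x y :: 'a. \<exists>!S. arc_image x y S) \<and>
     (\<forall>x y :: 'a. \<exists>(a::real) b \<phi>. a \<le> b \<and> \<phi> ` {a..b} = segment x y \<and>
        (\<forall>s\<in>{a..b}. \<forall>t\<in>{a..b}. dist (\<phi> s) (\<phi> t) = dist s t))"

definition rooted_weighted_real_tree :: "'a::polish_space \<Rightarrow> 'a measure \<Rightarrow> bool" where
  "rooted_weighted_real_tree r p \<longleftrightarrow>
     real_tree TYPE('a) \<and> prob_space p \<and> sets p = sets borel"

definition fringe_subtree :: "'a::topological_space \<Rightarrow> 'a \<Rightarrow> 'a set" where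
  "fringe_subtree r x = {y. x \<in> segment r y}"

definition branch_point :: "'a::topological_space \<Rightarrow> bool" where
  "branch_point x \<longleftrightarrow>
     (\<exists>a b c. a \<noteq> x \<and> b \<noteq> x \<and> c \<noteq> x \<and>
        segment x a \<inter> segment x b = {x} \<and>
        segment x a \<inter> segment x c = {x} \<and>
        segment x b \<inter> segment x c = {x})"

definition leaf :: "'a::topological_space \<Rightarrow> bool" where
  "leaf x \<longleftrightarrow> (\<forall>y z. x \<in> segment y z \<longrightarrow> x = y \<or> x = z)"

definition leaves :: "'a::topological_space set" where
  "leaves = {x. leaf x}"

definition skeleton :: "'a::topological_space set" where
  "skeleton = - leaves"

definition closed_support :: "'a::topological_space measure \<Rightarrow> 'a set" where
  "closed_support p = {x. \<forall>U. open U \<and> x \<in> U \<longrightarrow> emeasure p U > 0}"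

(* Length measure is regarded as a Borel measure on the whole tree that is carried by the
   skeleton. *)
definition is_length_measure :: "'a::polish_space measure \<Rightarrow> bool" where
  "is_length_measure L \<longleftrightarrow>
     sets L = sets borel \<and>
     leaves \<in> null_sets L \<and>
     (\<forall>x y. emeasure L (segment x y) = ennreal (dist x y))"

definition length_measure :: "'a::polish_space measure" where
  "length_measure = (THE L. is_length_measure L)"

definition IP_tree :: "'a::polish_space \<Rightarrow> 'a measure \<Rightarrow> bool" where
  "IP_tree r p \<longleftrightarrow>
     rooted_weighted_real_tree r p \<and>
     (UNIV :: 'a set) = (\<Union>x\<in>closed_support p. segment r x) \<and>
     (\<forall>x. branch_point x \<or> x \<in> closed_support p \<longrightarrow>
        dist r x + measure p (fringe_subtree r x) = 1)"

(* The integral is the sum of the masses of the points of A. *)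
definition purely_atomic :: "'a measure \<Rightarrow> bool" where
  "purely_atomic M \<longleftrightarrow>
     (\<forall>A\<in>sets M. emeasure M A = (\<integral>\<^sup>+x. emeasure M {x} \<partial>count_space A))"

definition diffuse :: "'a measure \<Rightarrow> bool" where
  "diffuse M \<longleftrightarrow> (\<forall>x\<in>space M. emeasure M {x} = 0)"

(* The density is the measure taking A to the length measure of S \<inter> A. *)
definition skeletal_length_restriction :: "'a::polish_space measure \<Rightarrow> bool" where
  "skeletal_length_restriction M \<longleftrightarrow>
     (\<exists>S\<in>sets borel. S \<subseteq> skeleton \<and> M = density length_measure (indicator S))"

definition diffuse_on_leaves :: "'a::polish_space measure \<Rightarrow> bool" where
  "diffuse_on_leaves M \<longleftrightarrow> diffuse M \<and> skeleton \<in> null_sets M"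

end

theory Submission
  imports Defs
begin

text \<open>
  For a point \<open>y\<close>, push \<open>p\<close> forward to the measure \<open>\<mu>\<close> on the heights along the segment from the
  root to \<open>y\<close>, by sending each point of the tree to the place where its own root segment leaves that
  segment. The mass of \<open>{t..}\<close> under \<open>\<mu>\<close> is the mass of a fringe subtree, so spacing says
  \<open>\<mu> {t..} = 1 - t\<close> whenever \<open>t\<close> is the height of a support point. This forces \<open>\<mu>\<close> to be Lebesgue
  measure on the set of these heights, up to a countable set. By separability only countably many
  heights receive mass from off the segment, so the diffuse part of \<open>p\<close> on the segment is length
  measure restricted to the closed support. The skeleton is covered by countably many segments
  starting at the root, hence the same holds on the skeleton. Uniqueness is immediate: the atomic
  part is read off from the masses of points, and the other two parts live on disjoint sets.
\<close>

section \<open>Geometry of real trees\<close>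

lemma arc_image_commute: "arc_image x y S \<Longrightarrow> arc_image y x S"
  unfolding arc_image_def
  by (metis arc_reversepath path_image_reversepath pathfinish_reversepath pathstart_reversepath)

lemma arc_image_endpoints: "arc_image x y S \<Longrightarrow> x \<in> S \<and> y \<in> S"
  unfolding arc_image_def by auto

text \<open>Arcs between two given points of a real tree are unique, so an isometric copy of an
  interval with the right ends is enough to identify a segment. Both \<open>geodesic_exists\<close>
  and \<open>in_segment_iff\<close> rest on this.\<close>

lemma arc_image_isometric:
  fixes \<phi> :: "real \<Rightarrow> 'a::metric_space"
  assumes "u \<le> v" and iso: "\<And>s t. s \<in> {u..v} \<Longrightarrow> t \<in> {u..v} \<Longrightarrow> dist (\<phi> s) (\<phi> t) = dist s t"
  shows "arc_image (\<phi> u) (\<phi> v) (\<phi> ` {u..v})"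
proof (cases "u = v")
  case True
  then show ?thesis by (simp add: arc_image_def)
next
  case False
  then have "u < v" using assms by simp
  define f where "f = (\<lambda>s. (v - u) * s + u)"
  have im: "f ` {0..1} = {u..v}"
    using \<open>u < v\<close> by (simp add: f_def image_affinity_atLeastAtMost)
  have inj: "inj_on \<phi> {u..v}"
    by (rule inj_onI) (metis iso dist_eq_0_iff)
  have cont: "continuous_on {u..v} \<phi>"
    unfolding continuous_on_iff using iso by metis
  have "arc (\<phi> \<circ> f)"
    unfolding arc_def path_def
  proof
    have "continuous_on {0..1} f"
      unfolding f_def by (intro continuous_intros)
    then show "continuous_on {0..1} (\<phi> \<circ> f)"
      using cont im by (intro continuous_on_compose) auto
    have "inj_on f {0..1}"
      using \<open>u < v\<close> by (auto simp: f_def inj_on_def)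
    then show "inj_on (\<phi> \<circ> f) {0..1}"
      using inj im by (simp add: comp_inj_on)
  qed
  moreover have "pathstart (\<phi> \<circ> f) = \<phi> u" "pathfinish (\<phi> \<circ> f) = \<phi> v"
    by (auto simp: f_def pathstart_def pathfinish_def)
  moreover have "path_image (\<phi> \<circ> f) = \<phi> ` {u..v}"
    by (simp only: path_image_def image_comp[symmetric] im)
  ultimately show ?thesis
    unfolding arc_image_def by metis
qed

locale rooted_real_tree =
  fixes r :: "'a::polish_space"
  assumes real_tree: "real_tree TYPE('a)"
begin

lemma arc_image_iff: "arc_image x y S \<longleftrightarrow> S = segment x y" for x y :: 'a
proof -
  have "\<exists>!S. arc_image x y S"
    using real_tree by (auto simp: real_tree_def)
  then show ?thesis
    unfolding segment_def by (metis theI')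
qed

lemma segment_commute: "segment x y = segment y x" for x y :: 'a
  using arc_image_commute arc_image_iff by metis

text \<open>The definition of a real tree supplies an isometry of some interval onto the segment
  without saying where the ends of the interval go. The piece between the parameters of
  \<open>x\<close> and \<open>y\<close> is itself an arc from \<open>x\<close> to \<open>y\<close>,
  so uniqueness makes its image the whole segment and injectivity makes it the whole interval. A
  shift or a reflection then lets the parameter start at \<open>x\<close>.\<close>

lemma geodesic_exists:
  fixes x y :: 'a
  shows "\<exists>\<phi>. \<phi> 0 = x \<and> \<phi> (dist x y) = y \<and> segment x y = \<phi> ` {0..dist x y} \<and>
    (\<forall>s\<in>{0..dist x y}. \<forall>t\<in>{0..dist x y}. dist (\<phi> s) (\<phi> t) = \<bar>s - t\<bar>)"
proof -
  have "\<exists>(a::real) b \<phi>. a \<le> b \<and> \<phi> ` {a..b} = segment x y \<and>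
      (\<forall>s\<in>{a..b}. \<forall>t\<in>{a..b}. dist (\<phi> s) (\<phi> t) = dist s t)"
    using real_tree unfolding real_tree_def by (elim conjE allE)
  then obtain a b :: real and \<phi> where ab: "a \<le> b" and im: "\<phi> ` {a..b} = segment x y"
    and iso': "\<forall>s\<in>{a..b}. \<forall>t\<in>{a..b}. dist (\<phi> s) (\<phi> t) = dist s t"
    by (elim exE conjE) (rule that; assumption)
  have iso: "dist (\<phi> s) (\<phi> t) = dist s t" if "s \<in> {a..b}" "t \<in> {a..b}" for s t
    using iso' that by blast
  have inj: "inj_on \<phi> {a..b}"
    by (rule inj_onI) (metis iso dist_eq_0_iff)
  have "arc_image x y (segment x y)"
    by (simp add: arc_image_iff)
  then have "x \<in> segment x y \<and> y \<in> segment x y"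
    by (rule arc_image_endpoints)
  then obtain u v where u: "u \<in> {a..b}" "\<phi> u = x" and v: "v \<in> {a..b}" "\<phi> v = y"
    unfolding im[symmetric] by auto
  have endpoints: "{a..b} = {min u v..max u v}"
  proof -
    have "arc_image (\<phi> (min u v)) (\<phi> (max u v)) (\<phi> ` {min u v..max u v})"
      using u v by (intro arc_image_isometric iso) auto
    then have "arc_image x y (\<phi> ` {min u v..max u v})"
      using u(2) v(2) by (cases "u \<le> v") (auto intro: arc_image_commute)
    then have "\<phi> ` {min u v..max u v} = segment x y"
      by (simp add: arc_image_iff)
    then have "\<phi> ` {min u v..max u v} = \<phi> ` {a..b}"
      using im by simp
    moreover have "{min u v..max u v} \<subseteq> {a..b}"
      using u v by auto
    ultimately show ?thesis
      using inj_on_image_eq_iff[OF inj, of "{min u v..max u v}" "{a..b}"]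
      by (simp del: atLeastatMost_subset_iff Icc_eq_Icc)
  qed
  then have eqs: "a = min u v" "b = max u v"
    using ab by (auto simp: Icc_eq_Icc)
  have d: "dist x y = \<bar>u - v\<bar>"
    using iso[OF u(1) v(1)] u(2) v(2) by (simp add: dist_real_def)
  show ?thesis
  proof (cases "u \<le> v")
    case True
    then have *: "a = u" "b = v" "dist x y = v - u"
      using eqs d by auto
    have im': "(\<lambda>t. u + t) ` {0..dist x y} = {a..b}"
      using * by simp
    have "\<phi> (u + 0) = x" "\<phi> (u + dist x y) = y"
      using * u v by auto
    moreover have "segment x y = (\<lambda>t. \<phi> (u + t)) ` {0..dist x y}"
      unfolding im[symmetric] im'[symmetric] image_image ..
    moreover have "dist (\<phi> (u + s)) (\<phi> (u + t)) = \<bar>s - t\<bar>"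
      if "s \<in> {0..dist x y}" "t \<in> {0..dist x y}" for s t
      using that * by (subst iso) (auto simp: dist_real_def)
    ultimately show ?thesis
      by (intro exI[of _ "\<lambda>t. \<phi> (u + t)"] conjI ballI; blast)
  next
    case False
    then have *: "a = v" "b = u" "dist x y = u - v"
      using eqs d by auto
    have im': "(\<lambda>t. u - t) ` {0..dist x y} = {a..b}"
      using * by (simp add: image_diff_atLeastAtMost)
    have "\<phi> (u - 0) = x" "\<phi> (u - dist x y) = y"
      using * u v by auto
    moreover have "segment x y = (\<lambda>t. \<phi> (u - t)) ` {0..dist x y}"
      unfolding im[symmetric] im'[symmetric] image_image ..
    moreover have "dist (\<phi> (u - s)) (\<phi> (u - t)) = \<bar>s - t\<bar>"
      if "s \<in> {0..dist x y}" "t \<in> {0..dist x y}" for s t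
      using that * by (subst iso) (auto simp: dist_real_def)
    ultimately show ?thesis
      by (intro exI[of _ "\<lambda>t. \<phi> (u - t)"] conjI ballI; blast)
  qed
qed

section \<open>Metric description of segments\<close>

lemma segment_dist:
  fixes x y :: 'a
  assumes "u \<in> segment x y" "v \<in> segment x y"
  shows "dist u v = \<bar>dist x u - dist x v\<bar>"
proof -
  obtain \<phi> where \<phi>: "\<phi> 0 = x" "\<phi> (dist x y) = y" "segment x y = \<phi> ` {0..dist x y}"
    "\<forall>s\<in>{0..dist x y}. \<forall>t\<in>{0..dist x y}. dist (\<phi> s) (\<phi> t) = \<bar>s - t\<bar>"
    using geodesic_exists[of x y] by (elim exE conjE) (rule that; assumption)
  obtain s t where st: "s \<in> {0..dist x y}" "t \<in> {0..dist x y}" "u = \<phi> s" "v = \<phi> t"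
    using assms \<phi>(3) by auto
  have "dist x u = s" "dist x v = t"
    using st(1,2) \<phi>(4)[rule_format, of 0 s] \<phi>(4)[rule_format, of 0 t] unfolding st(3,4) \<phi>(1) by auto
  moreover have "dist u v = \<bar>s - t\<bar>"
    unfolding st(3,4) using st(1,2) by (rule \<phi>(4)[rule_format])
  ultimately show ?thesis
    by simp
qed

text \<open>From right to left, isometries onto the segments from \<open>x\<close> to
  \<open>z\<close> and from \<open>z\<close> to \<open>y\<close> are glued at \<open>z\<close>.
  Equality in the triangle inequality makes the glued map isometric, so its image is an arc through
  \<open>z\<close> and, by uniqueness, the segment.\<close>

lemma in_segment_iff: "z \<in> segment x y \<longleftrightarrow> dist x z + dist z y = dist x y" for x y z :: 'a
proof
  assume z: "z \<in> segment x y"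
  obtain \<phi> where \<phi>: "\<phi> 0 = x" "\<phi> (dist x y) = y" "segment x y = \<phi> ` {0..dist x y}"
    "\<forall>s\<in>{0..dist x y}. \<forall>t\<in>{0..dist x y}. dist (\<phi> s) (\<phi> t) = \<bar>s - t\<bar>"
    using geodesic_exists[of x y] by (elim exE conjE) (rule that; assumption)
  obtain t where t: "t \<in> {0..dist x y}" "z = \<phi> t"
    using z \<phi>(3) by auto
  have "dist x z = t" "dist z y = dist x y - t"
    using t(1) \<phi>(4)[rule_format, of 0 t] \<phi>(4)[rule_format, of t "dist x y"] unfolding t(2) \<phi>(1,2) by auto
  then show "dist x z + dist z y = dist x y"
    by simp
next
  assume z: "dist x z + dist z y = dist x y"
  obtain \<phi> where \<phi>: "\<phi> 0 = x" "\<phi> (dist x z) = z" "segment x z = \<phi> ` {0..dist x z}"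
    "\<forall>s\<in>{0..dist x z}. \<forall>t\<in>{0..dist x z}. dist (\<phi> s) (\<phi> t) = \<bar>s - t\<bar>"
    using geodesic_exists[of x z] by (elim exE conjE) (rule that; assumption)
  obtain \<psi> where \<psi>: "\<psi> 0 = z" "\<psi> (dist z y) = y" "segment z y = \<psi> ` {0..dist z y}"
    "\<forall>s\<in>{0..dist z y}. \<forall>t\<in>{0..dist z y}. dist (\<psi> s) (\<psi> t) = \<bar>s - t\<bar>"
    using geodesic_exists[of z y] by (elim exE conjE) (rule that; assumption)
  define \<theta> where "\<theta> t = (if t \<le> dist x z then \<phi> t else \<psi> (t - dist x z))" for t
  \<comment> \<open>With the parameters on different sides of \<open>z\<close>, the detour through
    \<open>z\<close> bounds the distance from above; a smaller value would give a route from
    \<open>x\<close> to \<open>y\<close> shorter than their distance.\<close>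
  have cross: "dist (\<theta> s) (\<theta> t) = t - s" if "0 \<le> s" "s \<le> dist x z" "dist x z < t" "t \<le> dist x y" for s t
  proof -
    have a: "dist x (\<theta> s) = s" "dist (\<theta> s) z = dist x z - s"
      using that \<phi>(1,2) \<phi>(4)[rule_format, of 0 s] \<phi>(4)[rule_format, of s "dist x z"] by (auto simp: \<theta>_def)
    have b: "dist z (\<theta> t) = t - dist x z" "dist (\<theta> t) y = dist x y - t"
      using that z \<psi>(1,2) \<psi>(4)[rule_format, of 0 "t - dist x z"] \<psi>(4)[rule_format, of "t - dist x z" "dist z y"]
      by (auto simp: \<theta>_def)
    have "dist x y \<le> dist x (\<theta> s) + dist (\<theta> s) (\<theta> t) + dist (\<theta> t) y"
      using dist_triangle[of x y "\<theta> s"] dist_triangle[of "\<theta> s" y "\<theta> t"] by simp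
    then show ?thesis
      using a b dist_triangle[of "\<theta> s" "\<theta> t" z] by simp
  qed
  have "arc_image (\<theta> 0) (\<theta> (dist x y)) (\<theta> ` {0..dist x y})"
  proof (rule arc_image_isometric)
    fix s t assume st: "s \<in> {0..dist x y}" "t \<in> {0..dist x y}"
    consider "s \<le> dist x z" "t \<le> dist x z" | "s > dist x z" "t > dist x z"
      | "s \<le> dist x z" "t > dist x z" | "t \<le> dist x z" "s > dist x z"
      by linarith
    then show "dist (\<theta> s) (\<theta> t) = dist s t"
    proof cases
      case 1
      then show ?thesis using st \<phi>(4) by (simp add: \<theta>_def dist_real_def)
    next
      case 2
      then show ?thesis using st z \<psi>(4) by (simp add: \<theta>_def dist_real_def)
    next
      case 3
      then show ?thesis using st cross by (simp add: dist_real_def)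
    next
      case 4
      then show ?thesis using st cross[of t s] by (simp add: dist_real_def dist_commute)
    qed
  qed simp
  moreover have "\<theta> 0 = x" "\<theta> (dist x z) = z"
    using \<phi> by (auto simp: \<theta>_def)
  moreover have "\<theta> (dist x y) = y"
  proof (cases "z = y")
    case True
    then show ?thesis using \<phi>(2) by (simp add: \<theta>_def)
  next
    case False
    then have "\<not> dist x y \<le> dist x z" "dist x y - dist x z = dist z y"
      using z zero_less_dist_iff[of z y] by linarith+
    then show ?thesis using \<psi>(2) by (simp only: \<theta>_def if_False)
  qed
  ultimately have "segment x y = \<theta> ` {0..dist x y}"
    by (simp add: arc_image_iff)
  moreover have "dist x z \<in> {0..dist x y}"
    by (simp add: z[symmetric])
  ultimately show "z \<in> segment x y"
    using \<open>\<theta> (dist x z) = z\<close> by (metis imageI)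
qed

lemma endpoints_in_segment [simp]: "x \<in> segment x y" "y \<in> segment x y" for x y :: 'a
  by (auto simp: in_segment_iff)

lemma segment_point_at:
  fixes x y :: 'a
  assumes "0 \<le> t" "t \<le> dist x y"
  obtains z where "z \<in> segment x y" "dist x z = t"
proof -
  obtain \<phi> where \<phi>: "\<phi> 0 = x" "\<phi> (dist x y) = y" "segment x y = \<phi> ` {0..dist x y}"
    "\<forall>s\<in>{0..dist x y}. \<forall>t\<in>{0..dist x y}. dist (\<phi> s) (\<phi> t) = \<bar>s - t\<bar>"
    using geodesic_exists[of x y] by (elim exE conjE) (rule that; assumption)
  have "dist x (\<phi> t) = t"
    using assms \<phi>(1) \<phi>(4)[rule_format, of 0 t] by simp
  moreover have "\<phi> t \<in> segment x y"
    using assms \<phi>(3) by simp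
  ultimately show thesis
    using that by blast
qed

lemma segment_trans: "z \<in> segment x m \<Longrightarrow> m \<in> segment x y \<Longrightarrow> z \<in> segment x y" for x y z m :: 'a
  using dist_triangle[of z y m] dist_triangle[of x y z] by (auto simp: in_segment_iff)

lemma segment_initial:
  fixes x y z m :: 'a
  assumes "z \<in> segment x y" "m \<in> segment x y" "dist x z \<le> dist x m"
  shows "z \<in> segment x m"
  using segment_dist[OF assms(1,2)] assms(3) by (auto simp: in_segment_iff)

lemma closed_segment_tree: "closed (segment x y)" for x y :: 'a
proof -
  have "segment x y = {z. dist x z + dist z y = dist x y}"
    by (auto simp: in_segment_iff)
  then show ?thesis
    by (auto intro!: closed_Collect_eq continuous_intros)
qed

lemma compact_segment_tree: "compact (segment x y)" for x y :: 'a
proof -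
  have "arc_image x y (segment x y)"
    by (simp add: arc_image_iff)
  then show ?thesis
    unfolding arc_image_def by (metis arc_imp_path compact_path_image compact_sing)
qed

text \<open>Two arcs that meet only in their common end join to an arc, which uniqueness identifies
  with the segment.\<close>

lemma segment_concat:
  fixes x y m :: 'a
  assumes "segment x m \<inter> segment m y \<subseteq> {m}"
  shows "m \<in> segment x y"
proof (cases "m = x \<or> m = y")
  case True
  then show ?thesis by auto
next
  case False
  have "arc_image x m (segment x m)" "arc_image m y (segment m y)"
    by (auto simp: arc_image_iff)
  then obtain g h where g: "arc g" "pathstart g = x" "pathfinish g = m" "segment x m = path_image g"
    and h: "arc h" "pathstart h = m" "pathfinish h = y" "segment m y = path_image h"
    using False unfolding arc_image_def by blast
  have "arc (g +++ h)"
    using g h assms by (intro arc_join) auto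
  then have "arc_image x y (path_image (g +++ h))"
    unfolding arc_image_def using g h by (metis pathfinish_join pathstart_join)
  moreover have "m \<in> path_image (g +++ h)"
    using g h by (simp add: path_image_join) (metis pathfinish_in_path_image)
  ultimately show ?thesis
    using arc_image_iff by auto
qed

text \<open>The branching point is the last point of the segment from \<open>z\<close> to \<open>x\<close> that lies on the
  segment from \<open>z\<close> to \<open>y\<close>.\<close>
lemma tripodE:
  fixes x y z :: 'a
  obtains m where "m \<in> segment z x" "m \<in> segment z y" "m \<in> segment x y"
proof -
  let ?I = "segment z x \<inter> segment z y"
  have "compact ?I"
    by (intro compact_Int_closed compact_segment_tree closed_segment_tree)
  moreover have "?I \<noteq> {}"
    using endpoints_in_segment(1)[of z] by blast
  moreover have "continuous_on ?I (dist z)"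
    by (intro continuous_intros)
  ultimately obtain m where m: "m \<in> ?I" and max: "\<And>w. w \<in> ?I \<Longrightarrow> dist z w \<le> dist z m"
    using continuous_attains_sup[of ?I "dist z"] by blast
  \<comment> \<open>A point \<open>w\<close> on both continuations beyond \<open>m\<close> lies on
    both segments from \<open>z\<close>, so it is no farther from \<open>z\<close> than
    \<open>m\<close>. Lying between \<open>m\<close> and \<open>x\<close>, it is also no nearer, and
    so \<open>w\<close> is \<open>m\<close>.\<close>
  have "segment x m \<inter> segment m y \<subseteq> {m}"
  proof
    fix w assume w: "w \<in> segment x m \<inter> segment m y"
    then have "w \<in> segment x z" "w \<in> segment y z"
      using m segment_trans[of w x m z] segment_trans[of w y m z] by (auto simp: segment_commute)
    then have "dist z w \<le> dist z m"
      using max by (auto simp: segment_commute)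
    moreover have "dist z m + dist m x = dist z x" "dist z w + dist w x = dist z x"
      "dist x w + dist w m = dist x m"
      using m w \<open>w \<in> segment x z\<close> by (auto simp: in_segment_iff dist_commute add.commute)
    ultimately have "dist w m \<le> 0"
      using dist_commute[of m x] dist_commute[of w x] by linarith
    then show "w \<in> {m}" by simp
  qed
  then have "m \<in> segment x y"
    by (rule segment_concat)
  then show thesis
    using that m by auto
qed

text \<open>The height above the root of the point where the segments from the root to \<open>x\<close> and to \<open>y\<close> part.\<close>
definition gromov_product :: "'a \<Rightarrow> 'a \<Rightarrow> real" where
  "gromov_product x y = (dist r x + dist r y - dist x y) / 2"

section \<open>Common initial parts of root segments, measured by Gromov products\<close>

lemma gromov_product_double: "2 * gromov_product x y = dist r x + dist r y - dist x y"
  by (simp add: gromov_product_def)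

lemma gromov_product_commute: "gromov_product x y = gromov_product y x"
  by (simp add: gromov_product_def dist_commute add.commute)

lemma gromov_product_tripod:
  obtains m where "m \<in> segment r x" "m \<in> segment r y" "dist r m = gromov_product x y"
proof -
  obtain m where m: "m \<in> segment r x" "m \<in> segment r y" "m \<in> segment x y"
    by (rule tripodE)
  then have "dist r m = gromov_product x y"
    using dist_commute[of m x] gromov_product_double[of x y] unfolding in_segment_iff by linarith
  then show thesis
    using that m by blast
qed

text \<open>The root segments of \<open>y\<close> and \<open>z\<close> agree up to the point where
  they part and share nothing beyond it, so for points of one of them membership in the other is a
  condition on the height alone.\<close>

lemma in_root_segment_iff:
  assumes "x \<in> segment r y"
  shows "x \<in> segment r z \<longleftrightarrow> dist r x \<le> gromov_product y z"
proof
  assume "x \<in> segment r z"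
  then show "dist r x \<le> gromov_product y z"
    using assms dist_triangle[of y z x] dist_commute[of x y] gromov_product_double[of y z]
    unfolding in_segment_iff by linarith
next
  assume le: "dist r x \<le> gromov_product y z"
  obtain m where m: "m \<in> segment r y" "m \<in> segment r z" "dist r m = gromov_product y z"
    by (rule gromov_product_tripod)
  then have "x \<in> segment r m"
    using assms le by (simp add: segment_initial[of x r y])
  then show "x \<in> segment r z"
    using m(2) by (rule segment_trans)
qed

lemma gromov_product_segment: "z \<in> segment r y \<Longrightarrow> gromov_product y z = dist r z"
  using dist_commute[of y z] gromov_product_double[of y z] unfolding in_segment_iff by linarith

text \<open>One parting point belongs to \<open>x\<close> and \<open>y\<close>, another to
  \<open>y\<close> and \<open>z\<close>. The lower of the two lies on all three root
  segments.\<close>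

lemma gromov_product_ultrametric:
  "min (gromov_product x y) (gromov_product y z) \<le> gromov_product x z"
proof -
  obtain m where m: "m \<in> segment r x" "m \<in> segment r y" "dist r m = gromov_product x y"
    by (rule gromov_product_tripod)
  obtain n where n: "n \<in> segment r y" "n \<in> segment r z" "dist r n = gromov_product y z"
    by (rule gromov_product_tripod)
  show ?thesis
  proof (cases "dist r m \<le> dist r n")
    case True
    then have "m \<in> segment r z"
      using m(2) n(3) in_root_segment_iff[of m y z] by simp
    then have "dist r m \<le> gromov_product x z"
      using m(1) in_root_segment_iff[of m x z] by simp
    then show ?thesis
      using m(3) by simp
  next
    case False
    then have "n \<in> segment r x"
      using m(3) n(1) in_root_segment_iff[of n y x] by (simp add: gromov_product_commute)
    then have "dist r n \<le> gromov_product x z"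
      using n(2) in_root_segment_iff[of n x z] by simp
    then show ?thesis
      using n(3) by simp
  qed
qed

lemma gromov_product_ge: "dist r x - dist x y \<le> gromov_product x y"
  using dist_triangle[of r x y] by (simp add: gromov_product_def dist_commute)

lemma gromov_product_le: "gromov_product x y \<le> dist r x"
  using dist_triangle[of r y x] by (simp add: gromov_product_def dist_commute)

lemma gromov_product_eq_iff: "gromov_product y z = dist r z \<longleftrightarrow> z \<in> segment r y"
  using dist_commute[of y z] gromov_product_double[of y z] unfolding in_segment_iff by linarith

text \<open>The bound is the distance from \<open>z\<close> to the root segment of \<open>y\<close>.
  A point \<open>w\<close> nearer to \<open>z\<close> than that still follows the root segment of
  \<open>z\<close> when it leaves that of \<open>y\<close>; the ultrametric inequality, used in both
  directions, gives equality.\<close>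

lemma gromov_product_locally_constant:
  assumes "dist z w < dist r z - gromov_product y z"
  shows "gromov_product y w = gromov_product y z"
proof -
  have "gromov_product y z < gromov_product z w"
    using assms gromov_product_ge[of z w] by simp
  then show ?thesis
    using gromov_product_ultrametric[of y z w] gromov_product_ultrametric[of y w z]
      gromov_product_commute[of z w] by auto
qed

text \<open>By local constancy every value taken off the segment is already taken on a countable
  dense set. These are the only heights at which mass from off the segment can arrive.\<close>

lemma countable_gromov_product_off_segment: "countable (gromov_product y ` (- segment r y))"
proof -
  obtain D :: "'a set" where D: "countable D" "\<And>X. open X \<Longrightarrow> X \<noteq> {} \<Longrightarrow> \<exists>d\<in>D. d \<in> X"
    using countable_dense_exists by blast
  have "gromov_product y ` (- segment r y) \<subseteq> gromov_product y ` D"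
  proof (rule image_subsetI)
    fix z assume "z \<in> - segment r y"
    then have "gromov_product y z < dist r z"
      using gromov_product_le[of z y] gromov_product_eq_iff[of y z] gromov_product_commute[of y z] by simp
    then obtain d where "d \<in> D" "dist z d < dist r z - gromov_product y z"
      using D(2)[of "ball z (dist r z - gromov_product y z)"] by auto
    then show "gromov_product y z \<in> gromov_product y ` D"
      using gromov_product_locally_constant[of z d y] by (intro image_eqI[of _ _ d]) auto
  qed
  then show ?thesis
    using D(1) by (rule countable_subset[OF _ countable_image])
qed

section \<open>Root segments and the skeleton\<close>

text \<open>A small move of the far end \<open>a\<close> changes the root segment only near that
  end, so \<open>z\<close> stays on it. This allows far ends to be taken from a countable dense
  set.\<close>

lemma root_segment_approx:
  assumes "z \<in> segment r a" "dist a x < dist a z"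
  shows "z \<in> segment r x" "z \<noteq> x"
proof -
  have "dist r z \<le> gromov_product a x"
    using assms gromov_product_ge[of a x] by (simp add: in_segment_iff dist_commute)
  then show "z \<in> segment r x"
    using assms in_root_segment_iff by blast
qed (use assms in auto)

text \<open>A point inside a segment from \<open>a\<close> to \<open>b\<close> lies on one side of
  the point where the root segments of \<open>a\<close> and \<open>b\<close> part, and so on one of
  these two root segments.\<close>

lemma skeletonE:
  assumes "z \<in> skeleton"
  obtains a where "z \<in> segment r a" "z \<noteq> a"
proof -
  obtain a b where ab: "z \<in> segment a b" "z \<noteq> a" "z \<noteq> b"
    using assms by (auto simp: skeleton_def leaves_def leaf_def)
  obtain m where m: "m \<in> segment r a" "m \<in> segment r b" "m \<in> segment a b"
    by (rule tripodE)
  show thesis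
  proof (cases "dist a z \<le> dist a m")
    case True
    then have "z \<in> segment a m"
      using segment_initial ab m by blast
    then have "z \<in> segment r a"
      using m(1) segment_trans[of z a m r] by (simp add: segment_commute[of r])
    then show thesis
      using that ab by blast
  next
    case False
    then have "dist b z \<le> dist b m"
      using ab m by (simp add: in_segment_iff dist_commute)
    then have "z \<in> segment b m"
      using ab m segment_initial[of z b a m] by (simp add: segment_commute[of b])
    then have "z \<in> segment r b"
      using m(2) segment_trans[of z b m r] by (simp add: segment_commute[of r])
    then show thesis
      using that ab by blast
  qed
qed

lemma root_segment_leaves: "segment r x \<inter> leaves \<subseteq> {r, x}"
  by (auto simp: leaves_def leaf_def)

end

section \<open>Real measures with prescribed tails\<close>

lemma measure_eqI_atLeast:
  fixes M N :: "real measure"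
  assumes "sets M = sets borel" "sets N = sets borel"
    and "\<And>x. emeasure M {x..} < \<infinity>" "\<And>x. emeasure M {x..} = emeasure N {x..}"
  shows "M = N"
proof (rule measure_eqI_generator_eq_countable)
  let ?G = "\<lambda>a::real. {a..}"
  have "{a..} \<inter> {b..} = {max a b..}" for a b :: real
    by auto
  then show "Int_stable (range ?G)"
    by (auto simp: Int_stable_def)
  show "range ?G \<subseteq> Pow UNIV" "sets M = sigma_sets UNIV (range ?G)" "sets N = sigma_sets UNIV (range ?G)"
    unfolding assms borel_Ici by auto
  have "(\<Union>i\<in>Rats. ?G i) = UNIV"
    using Rats_no_bot_less less_imp_le by blast
  then show "?G ` Rats \<subseteq> range ?G" "(\<Union>i\<in>Rats. ?G i) = UNIV" "\<And>a. a \<in> ?G ` Rats \<Longrightarrow> emeasure M a \<noteq> \<infinity>"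
    using assms(3) by (auto simp: less_top)
qed (auto intro: assms countable_rat)

text \<open>Both measures are pushed forward along the map \<open>\<sigma>\<close> sending a point to the last point
  of \<open>K\<close> before it. The hypothesis makes the images equal, and \<open>\<sigma>\<close> moves only points which it sends
  to one of the countably many atoms of the image.\<close>
lemma tail_measure_eq_lborel:
  fixes M :: "real measure" and K :: "real set"
  assumes "finite_measure M" and sets: "sets M = sets borel" and "compact K"
    and tail: "\<And>t. t \<in> K \<Longrightarrow> measure M {t..} = c - t"
  obtains E where "countable E"
    "\<And>B. B \<in> sets borel \<Longrightarrow> B \<subseteq> K - E \<Longrightarrow> emeasure M B = emeasure lborel B"
proof (cases "K = {}")
  case True
  then show thesis
    using that[of "{}"] by auto
next
  case False
  interpret finite_measure M by fact
  note sets [measurable_cong]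
  obtain a where a: "a \<in> K" "\<And>t. t \<in> K \<Longrightarrow> a \<le> t"
    using compact_attains_inf[OF \<open>compact K\<close> False] by blast
  obtain b where b: "b \<in> K" "\<And>t. t \<in> K \<Longrightarrow> t \<le> b"
    using compact_attains_sup[OF \<open>compact K\<close> False] by blast
  \<comment> \<open>The maximum with the least point \<open>a\<close> of \<open>K\<close> keeps the
    set nonempty also for \<open>t\<close> below \<open>K\<close>; restricting to \<open>I\<close>
    later discards such \<open>t\<close>.\<close>
  have "\<exists>s\<in>K \<inter> {..max a t}. \<forall>u\<in>K \<inter> {..max a t}. u \<le> s" for t
  proof (rule compact_attains_sup)
    show "compact (K \<inter> {..max a t})"
      using \<open>compact K\<close> by (rule compact_Int_closed) simp
    show "K \<inter> {..max a t} \<noteq> {}"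
      using a(1) by auto
  qed
  then obtain \<sigma> where \<sigma>: "\<And>t. \<sigma> t \<in> K \<inter> {..max a t}"
    and greatest: "\<And>t. \<forall>u\<in>K \<inter> {..max a t}. u \<le> \<sigma> t"
    by metis
  have \<sigma>K: "\<sigma> t \<in> K" for t
    using \<sigma>[of t] by simp
  have \<sigma>_le: "\<sigma> t \<le> t" if "a \<le> t" for t
    using \<sigma>[of t] that by (simp add: max_absorb2)
  have le_\<sigma>: "u \<le> \<sigma> t" if "u \<in> K" "u \<le> t" for u t
    using greatest[of t] that by auto
  have "mono \<sigma>"
  proof (rule monoI)
    fix s t :: real assume "s \<le> t"
    then have "\<sigma> s \<in> K \<inter> {..max a t}"
      using \<sigma>[of s] by auto
    then show "\<sigma> s \<le> \<sigma> t"
      using greatest by blast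
  qed
  then have [measurable]: "\<sigma> \<in> borel_measurable borel"
    by (rule borel_measurable_mono)
  \<comment> \<open>Above \<open>b\<close> only the total mass of \<open>{b..}\<close> is
    prescribed. The interval is half-open so that the mass under \<open>M\<close> of its parts
    \<open>{k..<b}\<close> is a difference of two prescribed tails.\<close>
  define I where "I = {a..<b}"
  have [measurable]: "I \<in> sets borel"
    by (simp add: I_def)
  define push where "push N = distr (density N (indicator I)) borel \<sigma>" for N :: "real measure"
  have emeasure_push: "emeasure (push N) A = emeasure N (I \<inter> \<sigma> -` A)"
    if [measurable_cong]: "sets N = sets borel" and [measurable]: "A \<in> sets borel" for N A
  proof -
    have sp: "space N = UNIV"
      using sets_eq_imp_space_eq[OF that(1)] by simp
    have pre: "\<sigma> -` A \<in> sets borel"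
      using measurable_sets[of \<sigma> borel borel A] by simp
    have "emeasure (push N) A = emeasure (density N (indicator I)) (\<sigma> -` A)"
      unfolding push_def by (subst emeasure_distr) (simp_all add: sp)
    also have "\<dots> = emeasure N (I \<inter> \<sigma> -` A)"
      by (rule emeasure_restricted) (simp_all add: that pre)
    finally show ?thesis .
  qed
  have tail_eq: "emeasure (push M) {t..} = emeasure (push lborel) {t..}" for t
  proof (cases "t \<le> b")
    case False
    then have "\<sigma> -` {t..} = {}"
      using order_trans[OF _ b(2)[OF \<sigma>K]] by auto
    then show ?thesis
      by (simp add: emeasure_push sets)
  next
    case True
    have "compact (K \<inter> {t..})"
      using \<open>compact K\<close> by (rule compact_Int_closed) simp
    moreover have "K \<inter> {t..} \<noteq> {}"
      using True b(1) by auto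
    ultimately obtain k where k: "k \<in> K" "t \<le> k" and least: "\<And>u. u \<in> K \<Longrightarrow> t \<le> u \<Longrightarrow> k \<le> u"
      using compact_attains_inf[of "K \<inter> {t..}"] by auto
    \<comment> \<open>Since \<open>k\<close> is the first point of \<open>K\<close> from
      \<open>t\<close> on, the map reaches height \<open>t\<close> exactly when its argument reaches
      \<open>k\<close>. So every tail of the image is decided at a point of
      \<open>K\<close>.\<close>
    have "t \<le> \<sigma> x \<longleftrightarrow> k \<le> x" if "a \<le> x" for x
    proof
      assume "t \<le> \<sigma> x"
      then have "k \<le> \<sigma> x"
        using least[OF \<sigma>K] by blast
      then show "k \<le> x"
        using \<sigma>_le[OF that] by simp
    next
      assume "k \<le> x"
      then have "k \<le> \<sigma> x"
        using k(1) le_\<sigma> by blast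
      then show "t \<le> \<sigma> x"
        using k(2) by simp
    qed
    then have eq: "I \<inter> \<sigma> -` {t..} = {k..<b}"
      using a(2)[OF k(1)] by (auto simp: I_def)
    have "k \<le> b"
      using b(2) k(1) by blast
    then have "{k..<b} = {k..} - {b..}"
      by auto
    then have "measure M {k..<b} = measure M {k..} - measure M {b..}"
      using \<open>k \<le> b\<close> by (simp add: finite_measure_Diff sets)
    then have "measure M {k..<b} = b - k"
      using tail[OF k(1)] tail[OF b(1)] by simp
    then have "emeasure M {k..<b} = ennreal (b - k)"
      by (simp add: emeasure_eq_measure)
    then show ?thesis
      using \<open>k \<le> b\<close> by (simp add: emeasure_push sets eq)
  qed
  have push_eq: "push M = push lborel"
  proof (rule measure_eqI_atLeast)
    fix t
    show "emeasure (push M) {t..} < \<infinity>"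
      by (simp add: emeasure_push sets less_top[symmetric])
  qed (simp add: push_def, simp add: push_def, rule tail_eq)
  have "emeasure (push M) (space (push M)) \<noteq> \<infinity>"
    by (simp add: emeasure_push sets push_def[of M]) (simp add: emeasure_push sets push_def[symmetric])
  then interpret push: finite_measure "push M"
    by (rule finite_measureI)
  \<comment> \<open>The image is finite, so its atoms are countable. The point \<open>b\<close>
    joins them because it lies outside \<open>I\<close>.\<close>
  define E where "E = insert b {s. measure (push M) {s} \<noteq> 0}"
  show thesis
  proof (rule that)
    show "countable E"
      unfolding E_def using push.countable_support by simp
    fix B assume B: "B \<in> sets borel" "B \<subseteq> K - E"
    have "I \<inter> \<sigma> -` B = B"
    proof (intro equalityI subsetI)
      fix x assume x: "x \<in> B"
      then have "x \<in> I"
        using B(2) a(2)[of x] b(2)[of x] by (auto simp: I_def E_def)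
      moreover have "\<sigma> x = x"
        using x B(2) \<sigma>_le[of x] le_\<sigma>[of x x] a(2)[of x] by auto
      ultimately show "x \<in> I \<inter> \<sigma> -` B"
        using x by simp
    next
      fix x assume x: "x \<in> I \<inter> \<sigma> -` B"
      have "x = \<sigma> x"
      proof (rule ccontr)
        assume "x \<noteq> \<sigma> x"
        then have "\<sigma> x < x"
          using \<sigma>_le[of x] x by (auto simp: I_def)
        \<comment> \<open>All of the gap below \<open>x\<close> collapses to one point, which
          thereby receives positive Lebesgue mass and is an atom of the common image.\<close>
        have "{\<sigma> x..<x} \<subseteq> I \<inter> \<sigma> -` {\<sigma> x}"
        proof
          fix u assume u: "u \<in> {\<sigma> x..<x}"
          then have "\<sigma> u = \<sigma> x"
            using monoD[OF \<open>mono \<sigma>\<close>, of u x] le_\<sigma>[OF \<sigma>K, of x u] by auto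
          moreover have "u \<in> I"
            using u x a(2)[OF \<sigma>K, of x] by (auto simp: I_def)
          ultimately show "u \<in> I \<inter> \<sigma> -` {\<sigma> x}"
            by simp
        qed
        then have "emeasure lborel {\<sigma> x..<x} \<le> emeasure (push M) {\<sigma> x}"
          unfolding push_eq by (subst emeasure_push) (auto intro!: emeasure_mono)
        then have "emeasure (push M) {\<sigma> x} \<noteq> 0"
          using \<open>\<sigma> x < x\<close> by auto
        then have "\<sigma> x \<in> E"
          by (simp add: E_def push.emeasure_eq_measure)
        then show False
          using x B(2) by auto
      qed
      then show "x \<in> B"
        using x by simp
    qed
    then show "emeasure M B = emeasure lborel B"
      using emeasure_push[OF sets B(1)] emeasure_push[OF sets_lborel B(1)] push_eq by simp
  qed
qed

section \<open>Length measure\<close>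

context rooted_real_tree
begin

section \<open>Countable covers and measurability of the skeleton\<close>

lemma segment_self: "segment x x = {x}" for x :: 'a
  by (auto simp: in_segment_iff dist_commute)

text \<open>Replacing \<open>a\<close> by a point of a dense sequence nearer to it than
  \<open>z\<close> does not disturb \<open>z\<close>. Hence countably many root segments cover the
  skeleton.\<close>

lemma dense_sequence:
  obtains x :: "nat \<Rightarrow> 'a" where "\<And>z a. z \<in> segment r a \<Longrightarrow> z \<noteq> a \<Longrightarrow> \<exists>n. z \<in> segment r (x n) \<and> z \<noteq> x n"
proof -
  obtain D :: "'a set" where D: "countable D" "\<And>X. open X \<Longrightarrow> X \<noteq> {} \<Longrightarrow> \<exists>d\<in>D. d \<in> X"
    using countable_dense_exists by blast
  have "D \<noteq> {}"
    using D(2)[of UNIV] by auto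
  show thesis
  proof (rule that)
    fix z a assume z: "z \<in> segment r a" "z \<noteq> a"
    then obtain d where "d \<in> D" "dist a d < dist a z"
      using D(2)[of "ball a (dist a z)"] by auto
    moreover obtain n where "d = from_nat_into D n"
      using from_nat_into_surj[OF D(1) \<open>d \<in> D\<close>] by auto
    ultimately show "\<exists>n. z \<in> segment r (from_nat_into D n) \<and> z \<noteq> from_nat_into D n"
      using root_segment_approx[OF z(1)] by blast
  qed
qed

lemma borel_segment [measurable, simp]: "segment x y \<in> sets borel" for x y :: 'a
  by (simp add: closed_segment_tree)

lemma borel_skeleton [measurable, simp]: "(skeleton :: 'a set) \<in> sets borel"
proof -
  obtain x :: "nat \<Rightarrow> 'a" where x: "\<And>z a. z \<in> segment r a \<Longrightarrow> z \<noteq> a \<Longrightarrow> \<exists>n. z \<in> segment r (x n) \<and> z \<noteq> x n"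
    using dense_sequence by blast
  \<comment> \<open>The root is treated apart: it is an end of every root segment, and whether it is
    a leaf depends on the tree.\<close>
  have eq: "skeleton = (\<Union>n. segment r (x n) - {r, x n}) \<union> (skeleton \<inter> {r})"
  proof (intro equalityI subsetI)
    fix z :: 'a assume z: "z \<in> skeleton"
    then obtain a where "z \<in> segment r a" "z \<noteq> a"
      by (rule skeletonE)
    then show "z \<in> (\<Union>n. segment r (x n) - {r, x n}) \<union> (skeleton \<inter> {r})"
      using x[of z a] z by auto
  next
    fix z assume "z \<in> (\<Union>n. segment r (x n) - {r, x n}) \<union> (skeleton \<inter> {r})"
    then show "z \<in> skeleton"
      using root_segment_leaves by (auto simp: skeleton_def)
  qed
  have "(\<Union>n. segment r (x n) - {r, x n}) \<in> sets borel"
    by (intro sets.countable_UN) (auto intro!: sets.Diff)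
  moreover have "skeleton \<inter> {r} \<in> sets borel"
    by (cases "r \<in> skeleton") auto
  ultimately show ?thesis
    by (subst eq) (rule sets.Un)
qed

lemma borel_leaves [measurable, simp]: "(leaves :: 'a set) \<in> sets borel"
  using borel_comp[OF borel_skeleton] by (simp add: skeleton_def)

text \<open>Heights outside the range of the segment are clamped to it.\<close>
definition root_path :: "'a \<Rightarrow> real \<Rightarrow> 'a" where
  "root_path y t = (SOME z. z \<in> segment r y \<and> dist r z = max 0 (min t (dist r y)))"

section \<open>Heights along a root segment\<close>

lemma root_path: "root_path y t \<in> segment r y" "dist r (root_path y t) = max 0 (min t (dist r y))"
proof -
  obtain z where "z \<in> segment r y" "dist r z = max 0 (min t (dist r y))"
    by (rule segment_point_at[of "max 0 (min t (dist r y))" r y]) auto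
  then have "root_path y t \<in> segment r y \<and> dist r (root_path y t) = max 0 (min t (dist r y))"
    unfolding root_path_def
    by (intro someI[of "\<lambda>z. z \<in> segment r y \<and> dist r z = max 0 (min t (dist r y))" z]) simp
  then show "root_path y t \<in> segment r y" "dist r (root_path y t) = max 0 (min t (dist r y))"
    by auto
qed

lemma root_path_dist: "z \<in> segment r y \<Longrightarrow> root_path y (dist r z) = z"
  using segment_dist[OF root_path(1) , of z y "dist r z"] root_path(2)[of y "dist r z"] zero_le_dist[of z y]
  by (simp add: in_segment_iff)

lemma borel_measurable_root_path [measurable]: "root_path y \<in> borel_measurable borel"
proof (rule borel_measurable_continuous_onI)
  have "\<bar>max 0 (min s h) - max 0 (min t h)\<bar> \<le> \<bar>s - t\<bar>" for s t h :: real
    by (auto simp: max_def min_def)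
  then have "dist (root_path y s) (root_path y t) \<le> dist s t" for s t
    using segment_dist[OF root_path(1) root_path(1), of y s t] by (simp add: root_path(2) dist_real_def)
  then show "continuous_on UNIV (root_path y)"
    unfolding continuous_on_iff by (meson UNIV_I le_less_trans)
qed

text \<open>Images of Borel sets need not be Borel in general. Rewriting this image by a preimage
  under the continuous map \<open>root_path y\<close> settles measurability.\<close>

lemma dist_root_image:
  assumes "A \<subseteq> segment r y"
  shows "dist r ` A = {0..dist r y} \<inter> root_path y -` A"
proof (intro equalityI subsetI)
  fix t assume "t \<in> dist r ` A"
  then obtain z where z: "z \<in> A" "t = dist r z"
    by blast
  then have "z \<in> segment r y"
    using assms by blast
  then have "dist r z \<le> dist r y"
    using zero_le_dist[of z y] unfolding in_segment_iff by linarith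
  then show "t \<in> {0..dist r y} \<inter> root_path y -` A"
    using z root_path_dist[OF \<open>z \<in> segment r y\<close>] by simp
next
  fix t assume "t \<in> {0..dist r y} \<inter> root_path y -` A"
  then show "t \<in> dist r ` A"
    by (intro image_eqI[of _ _ "root_path y t"]) (auto simp: root_path(2))
qed

lemma borel_dist_root_image:
  assumes [measurable]: "A \<in> sets borel" and "A \<subseteq> segment r y"
  shows "dist r ` A \<in> sets borel"
proof -
  have "root_path y -` A \<in> sets borel"
    using measurable_sets[OF borel_measurable_root_path, of A y] by simp
  then show ?thesis
    by (simp add: dist_root_image[OF assms(2)])
qed

lemma inj_on_dist_root: "inj_on (dist r) (segment r y)"
  by (rule inj_on_inverseI[of _ "root_path y"]) (rule root_path_dist)

section \<open>Uniqueness of length measure\<close>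

text \<open>The prescribed lengths of segments fix all tails of the push-forward of \<open>L\<close>
  along the height, and with them the push-forward. Injectivity of the height on the segment
  recovers \<open>A\<close> from its image.\<close>

lemma is_length_measure_root_segment:
  fixes L :: "'a measure"
  assumes L: "is_length_measure L" and A: "A \<in> sets borel" "A \<subseteq> segment r y"
  shows "emeasure L A = emeasure lborel (dist r ` A)"
proof -
  have sets: "sets L = sets borel" and len: "\<And>x y. emeasure L (segment x y) = ennreal (dist x y)"
    using L by (auto simp: is_length_measure_def)
  note sets [measurable_cong]
  have sp: "space L = UNIV"
    using sets_eq_imp_space_eq[OF sets] by simp
  define N where "N = distr (density L (indicator (segment r y))) borel (dist r)"
  define P where "P = density lborel (indicator {0..dist r y} :: real \<Rightarrow> ennreal)"
  have N: "emeasure N B = emeasure L (segment r y \<inter> dist r -` B)" if [measurable]: "B \<in> sets borel" for B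
  proof -
    have pre: "dist r -` B \<in> sets borel"
      using measurable_sets[of "dist r" borel borel B] by simp
    have "emeasure N B = emeasure (density L (indicator (segment r y))) (dist r -` B)"
      unfolding N_def by (subst emeasure_distr) (simp_all add: sp)
    also have "\<dots> = emeasure L (segment r y \<inter> dist r -` B)"
      by (rule emeasure_restricted) (simp_all add: sets pre)
    finally show ?thesis .
  qed
  have P: "emeasure P B = emeasure lborel ({0..dist r y} \<inter> B)" if "B \<in> sets borel" for B
    unfolding P_def using that by (intro emeasure_restricted) auto
  have "N = P"
  proof (rule measure_eqI_lessThan)
    fix s :: real
    have le: "dist r z \<le> dist r y" if "z \<in> segment r y" for z
      using that zero_le_dist[of z y] unfolding in_segment_iff by linarith
    consider "s < 0" | "dist r y \<le> s" | "0 \<le> s" "s < dist r y"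
      by linarith
    then show "emeasure N {s<..} = emeasure P {s<..}"
    proof cases
      case 1
      then have "segment r y \<inter> dist r -` {s<..} = segment r y" "{0..dist r y} \<inter> {s<..} = {0..dist r y}"
        by (auto intro: less_le_trans[OF 1 zero_le_dist])
      then show ?thesis
        by (simp add: N P len)
    next
      case 2
      then have "segment r y \<inter> dist r -` {s<..} = {}" "{0..dist r y} \<inter> {s<..} = {}"
        using le by force+
      then show ?thesis
        by (simp add: N P)
    next
      case 3
      define z where "z = root_path y s"
      have z: "z \<in> segment r y" "dist r z = s"
        using 3 root_path[of y s] by (auto simp: z_def)
      \<comment> \<open>The part of the segment above height \<open>s\<close> is again a segment
        without its lower end, so its measure is known.\<close>
      have "segment r y \<inter> dist r -` {s<..} = segment z y - segment z z"
      proof (intro equalityI subsetI)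
        fix w assume w: "w \<in> segment r y \<inter> dist r -` {s<..}"
        then have "dist z w = dist r w - dist r z"
          using segment_dist[OF z(1), of w] z(2) by simp
        then have "w \<in> segment z y"
          using w z(1) by (simp add: in_segment_iff)
        moreover have "w \<noteq> z"
          using w z(2) by auto
        ultimately show "w \<in> segment z y - segment z z"
          by (simp add: segment_self)
      next
        fix w assume w: "w \<in> segment z y - segment z z"
        then have "w \<noteq> z"
          by auto
        have "w \<in> segment r y"
          using w z(1) segment_trans[of w y z r] by (simp add: segment_commute[of y])
        moreover have "dist z w + dist w y = dist z y" "0 < dist z w"
          using w \<open>w \<noteq> z\<close> by (simp_all add: in_segment_iff)
        then have "dist w y < dist z y"
          by linarith
        then have "s < dist r w"
          using \<open>w \<in> segment r y\<close> z unfolding in_segment_iff by linarith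
        ultimately show "w \<in> segment r y \<inter> dist r -` {s<..}"
          by simp
      qed
      moreover have "segment z z \<subseteq> segment z y"
        by (simp add: segment_self)
      ultimately have "emeasure N {s<..} = emeasure L (segment z y) - emeasure L (segment z z)"
        by (simp add: N emeasure_Diff len sets)
      also have "\<dots> = ennreal (dist r y - s)"
      proof -
        have "dist z y = dist r y - s"
          using z unfolding in_segment_iff by linarith
        then show ?thesis
          by (simp add: len)
      qed
      also have "\<dots> = emeasure P {s<..}"
      proof -
        have "{0..dist r y} \<inter> {s<..} = {s<..dist r y}"
          using 3 by auto
        then show ?thesis
          using 3 by (simp add: P)
      qed
      finally show ?thesis .
    qed
    have "emeasure N {s<..} \<le> emeasure L (segment r y)"
      by (simp add: N sets emeasure_mono)
    then show "emeasure N {s<..} < \<infinity>"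
      by (simp add: len le_less_trans[OF _ ennreal_less_top])
  qed (simp_all add: N_def P_def)
  have B: "dist r ` A \<in> sets borel"
    using A by (rule borel_dist_root_image)
  have "segment r y \<inter> dist r -` dist r ` A = A"
    using A(2) inj_on_dist_root[of y] by (auto dest: inj_onD)
  moreover have "{0..dist r y} \<inter> dist r ` A = dist r ` A"
    using dist_root_image[OF A(2)] by auto
  ultimately show ?thesis
    using N[OF B] P[OF B] \<open>N = P\<close> by simp
qed

text \<open>Countably many root segments cover the skeleton. Cut into disjoint pieces, they let
  equality on each root segment add up to equality on the whole skeleton.\<close>

lemma emeasure_eq_on_skeleton:
  fixes L M :: "'a measure"
  assumes sets: "sets L = sets borel" "sets M = sets borel"
    and eq: "\<And>A y. A \<in> sets borel \<Longrightarrow> A \<subseteq> segment r y \<Longrightarrow> emeasure L A = emeasure M A"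
    and A: "A \<in> sets borel" "A \<subseteq> skeleton"
  shows "emeasure L A = emeasure M A"
proof -
  obtain x :: "nat \<Rightarrow> 'a" where x: "\<And>z a. z \<in> segment r a \<Longrightarrow> z \<noteq> a \<Longrightarrow> \<exists>n. z \<in> segment r (x n) \<and> z \<noteq> x n"
    using dense_sequence by blast
  define D where "D n = A \<inter> disjointed (\<lambda>n. segment r (x n)) n" for n
  have Dsub: "D n \<subseteq> segment r (x n)" for n
    using disjointed_subset[of "\<lambda>n. segment r (x n)" n] by (auto simp: D_def)
  have Dsets: "D n \<in> sets borel" for n
    unfolding D_def disjointed_def using A(1) by (intro sets.Int sets.Diff sets.finite_UN) auto
  have Ddisj: "disjoint_family D"
    using disjoint_family_disjointed[of "\<lambda>n. segment r (x n)"]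
    by (auto simp: disjoint_family_on_def D_def)
  have "A \<subseteq> (\<Union>n. segment r (x n))"
  proof
    fix z assume "z \<in> A"
    then have "z \<in> skeleton"
      using A(2) by blast
    then obtain a where "z \<in> segment r a" "z \<noteq> a"
      by (rule skeletonE)
    then show "z \<in> (\<Union>n. segment r (x n))"
      using x[of z a] by auto
  qed
  then have A_eq: "(\<Union>n. D n) = A"
    unfolding D_def Int_UN_distrib[symmetric] UN_disjointed_eq by (rule Int_absorb2)
  have sum: "(\<Sum>n. emeasure N (D n)) = emeasure N A" if "sets N = sets borel" for N
    unfolding A_eq[symmetric] by (rule suminf_emeasure) (use Dsets Ddisj that in auto)
  have "(\<Sum>n. emeasure L (D n)) = (\<Sum>n. emeasure M (D n))"
    by (rule suminf_cong) (rule eq[OF Dsets Dsub])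
  then show ?thesis
    by (simp only: sum[OF sets(1)] sum[OF sets(2)])
qed

lemma length_measure_unique:
  fixes L M :: "'a measure"
  assumes L: "is_length_measure L" and M: "is_length_measure M"
  shows "L = M"
proof (rule measure_eqI)
  have sets: "sets L = sets borel" "sets M = sets borel"
    and null: "leaves \<in> null_sets L" "leaves \<in> null_sets M"
    using L M by (auto simp: is_length_measure_def)
  show "sets L = sets M"
    using sets by simp
  fix A assume "A \<in> sets L"
  then have A: "A \<in> sets borel"
    using sets by simp
  have skel: "emeasure N A = emeasure N (A - leaves)" if "sets N = sets borel" "leaves \<in> null_sets N" for N
    using emeasure_Diff_null_set[OF that(2), of A] A that(1) by simp
  have "emeasure L (A - leaves) = emeasure M (A - leaves)"
  proof (rule emeasure_eq_on_skeleton[OF sets])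
    show "emeasure L B = emeasure M B" if "B \<in> sets borel" "B \<subseteq> segment r y" for B y
      using is_length_measure_root_segment[OF L that] is_length_measure_root_segment[OF M that] by simp
    show "A - leaves \<in> sets borel"
      using A by simp
    show "A - leaves \<subseteq> skeleton"
      by (auto simp: skeleton_def)
  qed
  then show "emeasure L A = emeasure M A"
    by (simp only: skel[OF sets(1) null(1)] skel[OF sets(2) null(2)])
qed

section \<open>Existence of length measure\<close>

lemma dist_root_image_terminal_segment:
  assumes m: "m \<in> segment r y"
  shows "dist r ` segment m y = {dist r m..dist r y}"
proof (intro equalityI subsetI)
  fix t assume "t \<in> dist r ` segment m y"
  then obtain z where z: "z \<in> segment m y" "t = dist r z"
    by blast
  have "z \<in> segment r y"
    using z m segment_trans[of z y m r] by (simp add: segment_commute[of y])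
  then show "t \<in> {dist r m..dist r y}"
    using z m zero_le_dist[of m z] zero_le_dist[of z y]
    unfolding in_segment_iff atLeastAtMost_iff by linarith
next
  fix t assume t: "t \<in> {dist r m..dist r y}"
  have t0: "0 \<le> t"
    using t order_trans[OF zero_le_dist[of r m], of t] by simp
  let ?z = "root_path y t"
  have z: "?z \<in> segment r y" "dist r ?z = t"
    using t t0 by (auto simp: root_path)
  have "dist m ?z = t - dist r m"
    using segment_dist[OF m z(1)] z(2) t by simp
  then have "?z \<in> segment m y"
    using z m unfolding in_segment_iff by linarith
  then show "t \<in> dist r ` segment m y"
    using z(2) by (intro image_eqI[of _ _ ?z]) auto
qed

text \<open>Injectivity of the height on one root segment carries disjointness over to the images,
  so additivity is borrowed from Lebesgue measure. This serves both for the additivity of the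
  constructed set function and for its value on a root segment.\<close>

lemma suminf_lborel_dist_root_image:
  fixes B :: "nat \<Rightarrow> 'a set"
  assumes "\<And>n. B n \<in> sets borel" "\<And>n. B n \<subseteq> segment r y" "disjoint_family B"
  shows "(\<Sum>n. emeasure lborel (dist r ` B n)) = emeasure lborel (dist r ` (\<Union>n. B n))"
proof -
  have "dist r ` B m \<inter> dist r ` B n = {}" if "m \<noteq> n" for m n
  proof -
    have "dist r ` (B m \<inter> B n) = dist r ` B m \<inter> dist r ` B n"
      using inj_on_image_Int[OF inj_on_dist_root assms(2)[of m] assms(2)[of n]] .
    moreover have "B m \<inter> B n = {}"
      using assms(3) that by (auto simp: disjoint_family_on_def)
    ultimately show ?thesis by simp
  qed
  then have "disjoint_family (\<lambda>n. dist r ` B n)"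
    by (auto simp: disjoint_family_on_def)
  moreover have "range (\<lambda>n. dist r ` B n) \<subseteq> sets lborel"
    using borel_dist_root_image[OF assms(1) assms(2)] by (simp add: image_subset_iff)
  ultimately show ?thesis
    unfolding image_UN by (rule suminf_emeasure[rotated])
qed

text \<open>The countable cover by root segments is cut into disjoint pieces, and each piece is
  measured by the Lebesgue measure of its heights. Points outside all pieces are leaves and receive
  no mass.\<close>

lemma length_measure_exists: "\<exists>L :: 'a measure. is_length_measure L"
proof -
  obtain x :: "nat \<Rightarrow> 'a" where x: "\<And>z a. z \<in> segment r a \<Longrightarrow> z \<noteq> a \<Longrightarrow> \<exists>n. z \<in> segment r (x n) \<and> z \<noteq> x n"
    using dense_sequence by blast
  define D where "D = disjointed (\<lambda>n. segment r (x n))"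
  have Dsub: "D n \<subseteq> segment r (x n)" for n
    unfolding D_def by (rule disjointed_subset)
  have Dsets [measurable]: "D n \<in> sets borel" for n
    unfolding D_def disjointed_def by (intro sets.Diff sets.finite_UN) auto
  have Ddisj: "disjoint_family D"
    unfolding D_def by (rule disjoint_family_disjointed)
  have DUn: "(\<Union>n. D n) = (\<Union>n. segment r (x n))"
    unfolding D_def by (rule UN_disjointed_eq)
  define f where "f A = (\<Sum>n. emeasure lborel (dist r ` (A \<inter> D n)))" for A
  define L where "L = measure_of UNIV (sets borel) f"
  have sets: "sets L = sets borel"
    unfolding L_def using sets.sigma_sets_eq[of "borel :: 'a measure"] by (simp add: sets_measure_of_conv)
  have additive: "countably_additive (sets borel) f"
  proof (rule countably_additiveI)
    fix A :: "nat \<Rightarrow> 'a set"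
    assume A: "range A \<subseteq> sets borel" "disjoint_family A"
    \<comment> \<open>Tonelli for nonnegative double series, with one of the sums read as an
      integral over counting measure.\<close>
    have swap: "(\<Sum>i. \<Sum>n. g i n) = (\<Sum>n. \<Sum>i. g i n)" for g :: "nat \<Rightarrow> nat \<Rightarrow> ennreal"
      unfolding nn_integral_count_space_nat[symmetric, of "g _"]
      by (subst nn_integral_suminf[symmetric]) (simp_all add: nn_integral_count_space_nat)
    have "(\<Sum>i. f (A i)) = (\<Sum>n. \<Sum>i. emeasure lborel (dist r ` (A i \<inter> D n)))"
      unfolding f_def by (rule swap)
    also have "\<dots> = (\<Sum>n. emeasure lborel (dist r ` (\<Union>i. A i \<inter> D n)))"
    proof (intro suminf_cong suminf_lborel_dist_root_image)
      show "A i \<inter> D n \<subseteq> segment r (x n)" for i n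
        using Dsub by blast
      show "A i \<inter> D n \<in> sets borel" for i n
        using A(1) by auto
      show "disjoint_family (\<lambda>i. A i \<inter> D n)" for n
        using A(2) by (auto simp: disjoint_family_on_def)
    qed
    also have "\<dots> = f (\<Union>i. A i)"
      unfolding f_def by (intro suminf_cong arg_cong[of _ _ "emeasure lborel"] arg_cong[of _ _ "(`) (dist r)"]) auto
    finally show "(\<Sum>i. f (A i)) = f (\<Union>i. A i)" .
  qed
  have L: "emeasure L A = f A" if "A \<in> sets borel" for A
    unfolding L_def
  proof (rule emeasure_measure_of_sigma)
    show "sigma_algebra UNIV (sets (borel :: 'a measure))"
      using sets.sigma_algebra_axioms[of "borel :: 'a measure"] by simp
    show "positive (sets borel) f"
      by (simp add: positive_def f_def)
  qed (fact additive that)+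
  have L_root_segment: "emeasure L A = emeasure lborel (dist r ` A)" if A: "A \<in> sets borel" "A \<subseteq> segment r y" for A y
  proof -
    have "emeasure L A = emeasure lborel (dist r ` (\<Union>n. A \<inter> D n))"
      unfolding L[OF A(1)] f_def
    proof (rule suminf_lborel_dist_root_image)
      show "disjoint_family (\<lambda>n. A \<inter> D n)"
        using Ddisj by (auto simp: disjoint_family_on_def)
    qed (use A in auto)
    \<comment> \<open>The only point of \<open>A\<close> that the pieces can miss is the far end
      \<open>y\<close>; adding its height changes nothing.\<close>
    also have "\<dots> = emeasure lborel (dist r ` (\<Union>n. A \<inter> D n) \<union> dist r ` (A \<inter> {y} - (\<Union>n. D n)))"
    proof (rule emeasure_Un_null_set[symmetric])
      show "dist r ` (\<Union>n. A \<inter> D n) \<in> sets lborel"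
        using A by (auto intro!: borel_dist_root_image[where y = y])
      have "finite (dist r ` (A \<inter> {y} - (\<Union>n. D n)))"
        by simp
      then show "dist r ` (A \<inter> {y} - (\<Union>n. D n)) \<in> null_sets lborel"
        by (rule finite_imp_null_set_lborel)
    qed
    also have "dist r ` (\<Union>n. A \<inter> D n) \<union> dist r ` (A \<inter> {y} - (\<Union>n. D n)) = dist r ` A"
    proof -
      have "z \<in> (\<Union>n. D n)" if "z \<in> A" "z \<noteq> y" for z
        unfolding DUn using x[of z y] A(2) that by auto
      then have eq: "(\<Union>n. A \<inter> D n) \<union> (A \<inter> {y} - (\<Union>n. D n)) = A"
        by blast
      show ?thesis
        unfolding image_Un[symmetric] eq ..
    qed
    finally show ?thesis .
  qed
  have "leaves \<in> null_sets L"
  proof -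
    \<comment> \<open>Each piece lies on a root segment, and such a segment has no leaves except
      possibly its two ends.\<close>
    have "emeasure lborel (dist r ` (leaves \<inter> D n)) = 0" for n
    proof (rule emeasure_lborel_countable)
      have "leaves \<inter> D n \<subseteq> {r, x n}"
        using Dsub[of n] root_segment_leaves[of "x n"] by blast
      then show "countable (dist r ` (leaves \<inter> D n))"
        by (intro countable_image countable_finite) (rule finite_subset, auto)
    qed
    then have "f leaves = 0"
      by (simp add: f_def)
    then show ?thesis
      by (simp add: null_sets_def L sets)
  qed
  moreover have "emeasure L (segment u v) = ennreal (dist u v)" for u v
  proof -
    \<comment> \<open>An arbitrary segment is split at the point where the root segments of its ends
      part; each half is the terminal part of a root segment.\<close>
    obtain m where m: "m \<in> segment r u" "m \<in> segment r v" "m \<in> segment u v"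
      by (rule tripodE)
    have len: "emeasure L (segment m w) = ennreal (dist m w)" if "m \<in> segment r w" for w
    proof -
      have "segment m w \<subseteq> segment r w"
        using that segment_trans[of _ w m r] by (auto simp: segment_commute[of w])
      then have "emeasure L (segment m w) = emeasure lborel {dist r m..dist r w}"
        using L_root_segment[of "segment m w" w] dist_root_image_terminal_segment[OF that] by simp
      moreover have "dist r w = dist r m + dist m w"
        using that by (simp add: in_segment_iff)
      ultimately show ?thesis
        by simp
    qed
    have "{m} \<in> null_sets L"
      using L_root_segment[of "{m}" u] m(1) by (simp add: null_sets_def sets)
    have Un: "segment u v = segment m u \<union> (segment m v - {m})"
    proof (intro equalityI subsetI)
      fix z assume z: "z \<in> segment u v"
      show "z \<in> segment m u \<union> (segment m v - {m})"
      proof (cases "dist u z \<le> dist u m")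
        case True
        then have "z \<in> segment u m"
          using z m(3) by (intro segment_initial[OF _ _ True])
        then show ?thesis
          by (simp add: segment_commute[of m])
      next
        case False
        then have "dist v z \<le> dist v m"
          using z m(3) by (simp add: in_segment_iff dist_commute)
        then have "z \<in> segment v m"
          using z m(3) segment_initial[of z v u m] by (simp add: segment_commute[of v u])
        then show ?thesis
          using False by (auto simp: segment_commute[of m])
      qed
    next
      fix z assume "z \<in> segment m u \<union> (segment m v - {m})"
      then show "z \<in> segment u v"
        using m(3) segment_trans[of z u m v] segment_trans[of z v m u]
        by (auto simp: segment_commute[of m] segment_commute[of v u])
    qed
    have disj: "segment m u \<inter> (segment m v - {m}) = {}"
    proof -
      have "z = m" if "z \<in> segment m u" "z \<in> segment m v" for z
      proof -
        have "dist m z \<le> 0"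
          using that m(3) dist_triangle[of u v z] dist_commute[of m u] dist_commute[of z u] zero_le_dist[of m z]
          unfolding in_segment_iff by linarith
        then show ?thesis
          by simp
      qed
      then show ?thesis
        by blast
    qed
    have "emeasure L (segment u v) = emeasure L (segment m u) + emeasure L (segment m v - {m})"
      unfolding Un by (rule plus_emeasure[symmetric]) (use disj in \<open>auto simp: sets intro!: sets.Diff\<close>)
    also have "emeasure L (segment m v - {m}) = emeasure L (segment m v)"
      using \<open>{m} \<in> null_sets L\<close> by (intro emeasure_Diff_null_set) (auto simp: sets)
    also have "emeasure L (segment m u) + emeasure L (segment m v) = ennreal (dist m u + dist m v)"
      by (simp add: len[OF m(1)] len[OF m(2)])
    also have "dist m u + dist m v = dist u v"
      using m(3) by (simp add: in_segment_iff dist_commute)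
    finally show ?thesis .
  qed
  ultimately have "is_length_measure L"
    using sets by (simp add: is_length_measure_def)
  then show ?thesis ..
qed

lemma is_length_measure_length_measure: "is_length_measure (length_measure :: 'a measure)"
  unfolding length_measure_def
  by (rule theI', rule ex_ex1I) (fact length_measure_exists, fact length_measure_unique)

end

section \<open>The decomposition\<close>

text \<open>The complement is the union of all open null sets, which the Lindelof property reduces
  to a countable union.\<close>

lemma null_complement_closed_support:
  fixes p :: "'a::second_countable_topology measure"
  assumes "sets p = sets borel"
  shows "- closed_support p \<in> null_sets p" "closed (closed_support p)"
proof -
  let ?F = "{U. open U \<and> emeasure p U = 0}"
  have eq: "- closed_support p = \<Union>?F"
    by (auto simp: closed_support_def zero_less_iff_neq_zero)
  obtain F' where F': "F' \<subseteq> ?F" "countable F'" "\<Union>F' = \<Union>?F"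
    using Lindelof[of ?F] by blast
  have "\<Union>F' \<in> null_sets p"
  proof (rule null_sets_UN'[of F' "\<lambda>U. U", simplified])
    fix U assume "U \<in> F'"
    then show "U \<in> null_sets p"
      using F'(1) by (auto simp: null_sets_def assms)
  qed (use F' in auto)
  then show "- closed_support p \<in> null_sets p"
    by (simp add: eq F'(3))
  show "closed (closed_support p)"
    unfolding closed_def eq by auto
qed

lemma null_sets_countable_singletons:
  assumes "countable C" "\<And>x. x \<in> C \<Longrightarrow> {x} \<in> null_sets M"
  shows "C \<in> null_sets M"
  using null_sets_UN'[OF assms(1), of "\<lambda>x. {x}" M] assms(2) by simp

context rooted_real_tree
begin

lemma sets_length_measure [simp]: "sets (length_measure :: 'a measure) = sets borel"
  using is_length_measure_length_measure by (simp add: is_length_measure_def)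

lemma emeasure_length_measure_singleton [simp]: "emeasure length_measure {x :: 'a} = 0"
proof -
  have "emeasure length_measure (segment x x) = 0"
    using is_length_measure_length_measure by (simp add: is_length_measure_def)
  then show ?thesis
    by (simp add: segment_self)
qed

lemma borel_measurable_gromov_product [measurable]: "gromov_product y \<in> borel_measurable borel"
proof -
  have "(\<lambda>z. gromov_product y z) \<in> borel_measurable borel"
    unfolding gromov_product_def by (intro borel_measurable_continuous_onI continuous_intros) simp
  then show ?thesis .
qed

text \<open>In this form the mass of a fringe subtree is a tail of the push-forward along
  \<open>gromov_product y\<close>, which turns spacing into a statement about a measure on the
  line.\<close>

lemma fringe_subtree_eq:
  assumes "x \<in> segment r y"
  shows "fringe_subtree r x = {z. dist r x \<le> gromov_product y z}"
  using in_root_segment_iff[OF assms] by (simp add: fringe_subtree_def)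

text \<open>Spacing prescribes the tails of the push-forward at the heights of support points, so
  \<open>tail_measure_eq_lborel\<close> compares it with Lebesgue measure there. The result can be
  pulled back because all but countably many heights receive only points of the segment.\<close>

lemma diffuse_part_on_root_segment:
  assumes p: "IP_tree r p" and A: "A \<in> sets borel" "A \<subseteq> segment r y"
  shows "emeasure p (A - {x. measure p {x} \<noteq> 0}) = emeasure length_measure (closed_support p \<inter> A)"
proof -
  have "prob_space p" and sets: "sets p = sets borel"
    and spacing: "\<And>x. x \<in> closed_support p \<Longrightarrow> dist r x + measure p (fringe_subtree r x) = 1"
    using p by (auto simp: IP_tree_def rooted_weighted_real_tree_def)
  interpret prob_space p by fact
  note sets [measurable_cong]
  have sp: "space p = UNIV"
    using sets_eq_imp_space_eq[OF sets] by simp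
  define supp where "supp = closed_support p"
  have supp: "closed supp" "- supp \<in> null_sets p"
    using null_complement_closed_support[OF sets] by (auto simp: supp_def)
  define atoms where "atoms = {x. measure p {x} \<noteq> 0}"
  have "countable atoms"
    unfolding atoms_def by (rule countable_support)
  then have atoms: "atoms \<in> sets borel"
    by (rule sets.countable[rotated]) simp
  define M where "M = distr p borel (gromov_product y)"
  have M: "emeasure M B = emeasure p (gromov_product y -` B)" if "B \<in> sets borel" for B
    unfolding M_def by (subst emeasure_distr) (use that sp in simp_all)
  define K where "K = dist r ` (supp \<inter> segment r y)"
  have "compact K"
    unfolding K_def
  proof (intro compact_continuous_image continuous_intros)
    show "compact (supp \<inter> segment r y)"
      using closed_Int_compact[OF supp(1) compact_segment_tree] .
  qed
  moreover have "measure M {t..} = 1 - t" if t: "t \<in> K" for t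
  proof -
    obtain z where z: "z \<in> supp" "z \<in> segment r y" "t = dist r z"
      using t by (auto simp: K_def)
    have "gromov_product y -` {t..} = fringe_subtree r z"
      by (auto simp: fringe_subtree_eq[OF z(2)] z(3))
    then have "measure M {t..} = measure p (fringe_subtree r z)"
      using M[of "{t..}"] by (simp add: measure_def)
    then show ?thesis
      using spacing[of z] z by (simp add: supp_def)
  qed
  moreover have "finite_measure M"
    unfolding M_def by (rule finite_measure_distr) simp
  moreover have "sets M = sets borel"
    by (simp add: M_def)
  ultimately obtain E where E: "countable E"
    "\<And>B. B \<in> sets borel \<Longrightarrow> B \<subseteq> K - E \<Longrightarrow> emeasure M B = emeasure lborel B"
    using tail_measure_eq_lborel[of M K 1] by blast
  \<comment> \<open>The second set collects the heights hit from off the segment. At every other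
    height the preimage under the Gromov product contains only points of the segment.\<close>
  define E' where "E' = E \<union> gromov_product y ` (- segment r y)"
  have E': "countable E'"
    unfolding E'_def using E(1) countable_gromov_product_off_segment by simp
  have E'_borel: "E' \<in> sets borel"
    using E' by (rule sets.countable[rotated]) simp
  define B where "B = dist r ` (supp \<inter> A)"
  have suppA: "supp \<inter> A \<in> sets borel" "supp \<inter> A \<subseteq> segment r y"
    using supp(1) A by (auto intro: borel_closed)
  have B: "B \<in> sets borel" "B \<subseteq> K"
    unfolding B_def K_def using borel_dist_root_image[OF suppA] A(2) by auto
  have pre: "gromov_product y -` (B - E') = (supp \<inter> A) - dist r -` E'"
  proof (intro equalityI subsetI)
    fix w assume w: "w \<in> gromov_product y -` (B - E')"
    then have "w \<in> segment r y"
      by (auto simp: E'_def)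
    then have "dist r w \<in> dist r ` (supp \<inter> A)" "dist r w \<notin> E'"
      using w gromov_product_segment[of w y] by (auto simp: B_def)
    then show "w \<in> (supp \<inter> A) - dist r -` E'"
      using inj_on_image_mem_iff[OF inj_on_dist_root \<open>w \<in> segment r y\<close> suppA(2)] by simp
  next
    fix w assume w: "w \<in> (supp \<inter> A) - dist r -` E'"
    then have "gromov_product y w = dist r w"
      using suppA(2) by (intro gromov_product_segment) auto
    then show "w \<in> gromov_product y -` (B - E')"
      using w by (simp add: B_def)
  qed
  have "emeasure p (A - atoms) = emeasure p ((supp \<inter> A) - dist r -` E')"
  proof (rule emeasure_eq_AE)
    \<comment> \<open>A height determines a point of the segment, so the non-atoms at exceptional
      heights form a countable, hence null, set. Outside it, and within the closed support, the two
      sets agree.\<close>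
    define C where "C = root_path y ` E' - atoms"
    have "C \<in> null_sets p"
    proof (rule null_sets_countable_singletons)
      show "countable C"
        unfolding C_def using E' by simp
      show "{x} \<in> null_sets p" if "x \<in> C" for x
        using that by (simp add: C_def atoms_def null_sets_def sets emeasure_eq_measure)
    qed
    then have "AE x in p. x \<notin> C \<and> x \<notin> - supp"
      using supp(2) by (intro AE_conjI AE_not_in)
    then show "AE x in p. x \<in> A - atoms \<longleftrightarrow> x \<in> (supp \<inter> A) - dist r -` E'"
    proof (rule AE_mp, intro AE_I2 impI iffI)
      fix x assume x: "x \<notin> C \<and> x \<notin> - supp" and xA: "x \<in> A - atoms"
      have "x \<in> segment r y"
        using xA A(2) by auto
      then have "dist r x \<notin> E'"
        using root_path_dist[of x y] x xA by (auto simp: C_def image_iff)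
      then show "x \<in> (supp \<inter> A) - dist r -` E'"
        using x xA by auto
    next
      \<comment> \<open>An atom at a height outside \<open>E'\<close> would be an atom of
        \<open>M\<close> where \<open>M\<close> agrees with Lebesgue measure.\<close>
      fix x assume x: "x \<in> (supp \<inter> A) - dist r -` E'"
      then have "emeasure M {dist r x} = emeasure lborel {dist r x}"
        using suppA(2) by (intro E(2)) (auto simp: K_def E'_def)
      moreover have "{x} \<subseteq> gromov_product y -` {dist r x}"
        using x suppA(2) gromov_product_segment[of x y] by auto
      then have "emeasure p {x} \<le> emeasure M {dist r x}"
        unfolding M[OF borel_singleton[OF sets.empty_sets]]
        using measurable_sets[OF borel_measurable_gromov_product, of "{dist r x}" y]
        by (intro emeasure_mono) (simp_all add: sets)
      ultimately have "measure p {x} = 0"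
        by (simp add: emeasure_eq_measure)
      then show "x \<in> A - atoms"
        using x by (simp add: atoms_def)
    qed
    show "A - atoms \<in> sets p"
      using A(1) atoms by (simp add: sets sets.Diff)
    show "supp \<inter> A - dist r -` E' \<in> sets p"
      using measurable_sets[OF borel_measurable_gromov_product, of "B - E'" y] B E'_borel
      by (simp add: pre[symmetric] sets)
  qed
  also have "\<dots> = emeasure M (B - E')"
    using M[of "B - E'"] B(1) E'_borel by (simp add: pre)
  also have "\<dots> = emeasure lborel (B - E')"
    using B E'_borel by (intro E(2)) (auto simp: E'_def)
  also have "\<dots> = emeasure lborel B"
    using B(1) countable_imp_null_set_lborel[OF E'] by (intro emeasure_Diff_null_set) simp_all
  also have "\<dots> = emeasure length_measure (supp \<inter> A)"
    unfolding B_def using is_length_measure_root_segment[OF is_length_measure_length_measure suppA] by simp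
  finally show ?thesis
    by (simp only: supp_def atoms_def)
qed

section \<open>Uniqueness and existence of the decomposition\<close>

text \<open>Neither \<open>ps\<close> nor \<open>pl\<close> charges points, so \<open>pa\<close> has
  the point masses of \<open>p\<close>. With \<open>pa\<close> known, intersecting with the skeleton
  removes \<open>pl\<close> and intersecting with the leaves removes \<open>ps\<close>.\<close>

lemma decomposition_determined:
  assumes "finite_measure p" and sets: "sets pa = sets borel" "sets ps = sets borel" "sets pl = sets borel"
    and pa: "purely_atomic pa" and ps: "skeletal_length_restriction ps" and pl: "diffuse_on_leaves pl"
    and sum: "\<forall>A\<in>sets borel. emeasure p A = emeasure pa A + emeasure ps A + emeasure pl A"
    and A: "(A :: 'a set) \<in> sets borel"
  defines "atomic \<equiv> \<lambda>A. \<integral>\<^sup>+x. emeasure p {x} \<partial>count_space A"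
  shows "emeasure pa A = atomic A"
    and "emeasure ps A = emeasure p (A \<inter> skeleton) - atomic (A \<inter> skeleton)"
    and "emeasure pl A = emeasure p (A \<inter> leaves) - atomic (A \<inter> leaves)"
proof -
  interpret finite_measure p by fact
  have p: "emeasure p B = emeasure pa B + emeasure ps B + emeasure pl B" if "B \<in> sets borel" for B
    using sum that by blast
  obtain S where S: "S \<in> sets borel" "S \<subseteq> skeleton" "ps = density length_measure (indicator S)"
    using ps by (auto simp: skeletal_length_restriction_def)
  have ps_eq: "emeasure ps B = emeasure length_measure (S \<inter> B)" if "B \<in> sets borel" for B
    unfolding S(3) by (rule emeasure_restricted) (simp_all add: S(1) that)
  have "emeasure ps {x} = 0" for x
    using ps_eq[of "{x}"] by (cases "x \<in> S") auto
  moreover have "emeasure pl {x} = 0" for x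
    using pl sets_eq_imp_space_eq[OF sets(3)] by (simp add: diffuse_on_leaves_def diffuse_def)
  ultimately have "emeasure pa {x} = emeasure p {x}" for x
    using p[of "{x}"] by simp
  then have atomic: "emeasure pa B = atomic B" if "B \<in> sets borel" for B
    using pa that sets(1) by (simp add: purely_atomic_def atomic_def)
  show "emeasure pa A = atomic A"
    using A by (rule atomic)
  have rest: "emeasure ps B + emeasure pl B = emeasure p B - atomic B" if "B \<in> sets borel" for B
  proof -
    have "emeasure p B = atomic B + (emeasure ps B + emeasure pl B)"
      using p[OF that] atomic[OF that] by (simp add: add.assoc)
    \<comment> \<open>Cancellation in \<open>ennreal\<close> needs a finite term; the atomic mass is
      bounded by the finite mass of \<open>p\<close>.\<close>
    moreover from this have "atomic B \<noteq> \<infinity>"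
      using emeasure_finite[of B] by auto
    ultimately show ?thesis
      by simp
  qed
  have skel: "skeleton \<in> null_sets pl"
    using pl by (simp add: diffuse_on_leaves_def)
  have "emeasure pl (A \<inter> skeleton) = 0"
    using null_set_Int1[OF skel, of A] A by (auto simp: sets Int_commute)
  moreover have "emeasure ps (A \<inter> skeleton) = emeasure ps A"
  proof -
    have "S \<inter> (A \<inter> skeleton) = S \<inter> A"
      using S(2) by auto
    then show ?thesis
      using ps_eq[of A] ps_eq[of "A \<inter> skeleton"] A by simp
  qed
  ultimately show "emeasure ps A = emeasure p (A \<inter> skeleton) - atomic (A \<inter> skeleton)"
    using rest[of "A \<inter> skeleton"] A by simp
  have "emeasure ps (A \<inter> leaves) = 0"
  proof -
    have "S \<inter> (A \<inter> leaves) = {}"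
      using S(2) by (auto simp: skeleton_def)
    then show ?thesis
      using ps_eq[of "A \<inter> leaves"] A by simp
  qed
  moreover have "emeasure pl (A \<inter> leaves) = emeasure pl A"
  proof -
    have "A \<inter> leaves = A - skeleton"
      by (auto simp: skeleton_def)
    then show ?thesis
      using emeasure_Diff_null_set[OF skel, of A] A by (simp add: sets)
  qed
  ultimately show "emeasure pl A = emeasure p (A \<inter> leaves) - atomic (A \<inter> leaves)"
    using rest[of "A \<inter> leaves"] A by simp
qed

lemma decomposition_exists:
  assumes p: "IP_tree r p"
  shows "\<exists>pa ps pl. sets pa = sets borel \<and> sets ps = sets borel \<and> sets pl = sets borel \<and>
           purely_atomic pa \<and> skeletal_length_restriction ps \<and> diffuse_on_leaves pl \<and>
           (\<forall>A\<in>sets borel. emeasure p A = emeasure pa A + emeasure ps A + emeasure pl A)"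
proof -
  have "prob_space p" and sets: "sets p = sets borel"
    using p by (auto simp: IP_tree_def rooted_weighted_real_tree_def)
  interpret prob_space p by fact
  have supp: "closed_support p \<in> sets borel"
    using null_complement_closed_support(2)[OF sets] by (rule borel_closed)
  define D where "D = {x. measure p {x} \<noteq> 0}"
  have "countable D"
    unfolding D_def by (rule countable_support)
  then have D: "D \<in> sets borel"
    by (rule sets.countable[rotated]) simp
  \<comment> \<open>Two of the witnesses are restrictions of \<open>p\<close>, to its atoms and to
    the leaves that are not atoms. The remaining one is length measure on the part of the closed
    support in the skeleton.\<close>
  define pa where "pa = density p (indicator D)"
  define ps where "ps = density length_measure (indicator (closed_support p \<inter> skeleton) :: 'a \<Rightarrow> ennreal)"
  define pl where "pl = density p (indicator (leaves - D))"
  have pa: "emeasure pa A = emeasure p (D \<inter> A)" if "A \<in> sets borel" for A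
    unfolding pa_def by (rule emeasure_restricted) (simp_all add: sets D that)
  have ps: "emeasure ps A = emeasure length_measure (closed_support p \<inter> skeleton \<inter> A)" if "A \<in> sets borel" for A
    unfolding ps_def by (rule emeasure_restricted) (simp_all add: supp that sets.Int)
  have pl: "emeasure pl A = emeasure p ((leaves - D) \<inter> A)" if "A \<in> sets borel" for A
    unfolding pl_def by (rule emeasure_restricted) (simp_all add: sets D that sets.Diff)
  have "purely_atomic pa"
    unfolding purely_atomic_def
  proof
    fix A assume "A \<in> sets pa"
    then have A: "A \<in> sets borel"
      by (simp add: pa_def sets)
    have "emeasure pa A = emeasure p (D \<inter> A)"
      using A by (rule pa)
    also have "\<dots> = (\<integral>\<^sup>+x. emeasure p {x} \<partial>count_space (D \<inter> A))"
      using \<open>countable D\<close> by (intro emeasure_countable_singleton) (auto simp: sets)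
    also have "\<dots> = (\<integral>\<^sup>+x. emeasure pa {x} \<partial>count_space (D \<inter> A))"
      by (rule nn_integral_cong) (simp add: pa)
    also have "\<dots> = (\<integral>\<^sup>+x. emeasure pa {x} \<partial>count_space A)"
      by (rule nn_integral_count_space_eq) (auto simp: pa)
    finally show "emeasure pa A = (\<integral>\<^sup>+x. emeasure pa {x} \<partial>count_space A)" .
  qed
  moreover have "skeletal_length_restriction ps"
    unfolding skeletal_length_restriction_def ps_def
    using supp by (intro bexI[of _ "closed_support p \<inter> skeleton"] conjI refl) (auto intro: sets.Int)
  moreover have "diffuse_on_leaves pl"
    unfolding diffuse_on_leaves_def diffuse_def
  proof (intro conjI ballI)
    fix x
    show "emeasure pl {x} = 0"
    proof (cases "x \<in> leaves - D")
      case True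
      then show ?thesis
        by (simp add: pl D_def emeasure_eq_measure)
    next
      case False
      then show ?thesis
        by (simp add: pl)
    qed
    have "(leaves - D) \<inter> skeleton = {}"
      by (auto simp: skeleton_def)
    then show "skeleton \<in> null_sets pl"
      by (simp add: null_sets_def pl) (simp add: pl_def sets)
  qed
  moreover have "emeasure p A = emeasure pa A + emeasure ps A + emeasure pl A" if A: "A \<in> sets borel" for A
  proof -
    \<comment> \<open>Both densities live on the whole tree, so they can be compared on every root
      segment by \<open>diffuse_part_on_root_segment\<close> and then patched together on the
      skeleton.\<close>
    have "emeasure (density p (indicator (- D))) (A \<inter> skeleton) =
        emeasure (density length_measure (indicator (closed_support p))) (A \<inter> skeleton)"
    proof (rule emeasure_eq_on_skeleton)
      fix B y assume B: "B \<in> sets borel" "B \<subseteq> segment r y"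
      have "emeasure (density p (indicator (- D))) B = emeasure p (- D \<inter> B)"
        by (rule emeasure_restricted) (use B D in \<open>simp_all add: sets borel_comp\<close>)
      also have "- D \<inter> B = B - D"
        by auto
      also have "emeasure p (B - D) = emeasure length_measure (closed_support p \<inter> B)"
        unfolding D_def by (rule diffuse_part_on_root_segment[OF p B])
      also have "\<dots> = emeasure (density length_measure (indicator (closed_support p))) B"
        by (rule emeasure_restricted[symmetric]) (use B supp in simp_all)
      finally show "emeasure (density p (indicator (- D))) B =
          emeasure (density length_measure (indicator (closed_support p))) B" .
    qed (use A sets in auto)
    also have "emeasure (density p (indicator (- D))) (A \<inter> skeleton) = emeasure p (- D \<inter> (A \<inter> skeleton))"
      by (rule emeasure_restricted) (use A D in \<open>simp_all add: sets borel_comp\<close>)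
    also have "emeasure (density length_measure (indicator (closed_support p))) (A \<inter> skeleton) =
        emeasure length_measure (closed_support p \<inter> (A \<inter> skeleton))"
      by (rule emeasure_restricted) (use A supp in simp_all)
    finally have ps': "emeasure ps A = emeasure p (- D \<inter> (A \<inter> skeleton))"
      using ps[OF A] by (simp add: ac_simps)
    have [simp]: "D \<inter> A \<in> sets p" "- D \<inter> (A \<inter> skeleton) \<in> sets p" "(leaves - D) \<inter> A \<in> sets p"
      using A D borel_comp[OF D] by (simp_all add: sets sets.Int sets.Diff)
    \<comment> \<open>It remains to split \<open>A\<close> into atoms, non-atoms of the skeleton and
      non-atomic leaves.\<close>
    have "emeasure p (D \<inter> A) + emeasure p (- D \<inter> (A \<inter> skeleton)) =
        emeasure p (D \<inter> A \<union> - D \<inter> (A \<inter> skeleton))"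
      by (rule plus_emeasure) auto
    moreover have "emeasure p (D \<inter> A \<union> - D \<inter> (A \<inter> skeleton)) + emeasure p ((leaves - D) \<inter> A) =
        emeasure p ((D \<inter> A \<union> - D \<inter> (A \<inter> skeleton)) \<union> (leaves - D) \<inter> A)"
    proof (rule plus_emeasure)
      show "D \<inter> A \<union> - D \<inter> (A \<inter> skeleton) \<in> sets p"
        by (rule sets.Un) simp_all
    qed (auto simp: skeleton_def)
    moreover have "(D \<inter> A \<union> - D \<inter> (A \<inter> skeleton)) \<union> (leaves - D) \<inter> A = A"
      by (auto simp: skeleton_def)
    ultimately show ?thesis
      using pa[OF A] pl[OF A] ps' by simp
  qed
  moreover have "sets pa = sets borel" "sets ps = sets borel" "sets pl = sets borel"
    by (simp_all add: pa_def ps_def pl_def sets)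
  ultimately show ?thesis
    by blast
qed

end

theorem theorem4:
  fixes r :: "'a::polish_space" and p :: "'a measure"
  assumes "IP_tree r p"
  shows "\<exists>!(pa, ps, pl).
           sets pa = sets borel \<and> sets ps = sets borel \<and> sets pl = sets borel \<and>
           purely_atomic pa \<and>
           skeletal_length_restriction ps \<and>
           diffuse_on_leaves pl \<and>
           (\<forall>A\<in>sets borel. emeasure p A = emeasure pa A + emeasure ps A + emeasure pl A)"
proof -
  interpret rooted_real_tree r
    using assms by unfold_locales (simp add: IP_tree_def rooted_weighted_real_tree_def)
  have fin: "finite_measure p"
    using assms by (simp add: IP_tree_def rooted_weighted_real_tree_def prob_space.finite_measure)
  let ?P = "\<lambda>pa ps pl :: 'a measure.
           sets pa = sets borel \<and> sets ps = sets borel \<and> sets pl = sets borel \<and>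
           purely_atomic pa \<and>
           skeletal_length_restriction ps \<and>
           diffuse_on_leaves pl \<and>
           (\<forall>A\<in>sets borel. emeasure p A = emeasure pa A + emeasure ps A + emeasure pl A)"
  let ?atomic = "\<lambda>A. \<integral>\<^sup>+x. emeasure p {x} \<partial>count_space A"
  have det: "emeasure pa A = ?atomic A \<and>
      emeasure ps A = emeasure p (A \<inter> skeleton) - ?atomic (A \<inter> skeleton) \<and>
      emeasure pl A = emeasure p (A \<inter> leaves) - ?atomic (A \<inter> leaves)"
    if "?P pa ps pl" "A \<in> sets borel" for pa ps pl A
    using decomposition_determined[OF fin, of pa ps pl A] that by blast
  have unique: "pa = qa \<and> ps = qs \<and> pl = ql" if P: "?P pa ps pl" and Q: "?P qa qs ql" for pa ps pl qa qs ql
  proof -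
    have sets: "sets pa = sets qa" "sets ps = sets qs" "sets pl = sets ql"
      using P Q by simp_all
    have eq: "emeasure pa A = emeasure qa A \<and> emeasure ps A = emeasure qs A \<and> emeasure pl A = emeasure ql A"
      if "A \<in> sets borel" for A
      using det[OF P that] det[OF Q that] by simp
    have "pa = qa" "ps = qs" "pl = ql"
      by (rule measure_eqI; use P sets eq in blast)+
    then show ?thesis
      by simp
  qed
  obtain pa ps pl where P: "?P pa ps pl"
    using decomposition_exists[OF assms] by blast
  show ?thesis
  proof (rule ex1I[of _ "(pa, ps, pl)"])
    show "case (pa, ps, pl) of (pa, ps, pl) \<Rightarrow> ?P pa ps pl"
      using P by simp
    fix q assume q: "case q of (pa, ps, pl) \<Rightarrow> ?P pa ps pl"
    obtain qa qs ql where q_eq: "q = (qa, qs, ql)"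
      by (cases q)
    have "?P qa qs ql"
      using q unfolding q_eq by simp
    then show "q = (pa, ps, pl)"
      using unique[OF _ P] q_eq by blast
  qed
qed

end
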